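(* For every fixed integer $k\ge 1$, $\pi_k(\mathrm{planar}\cap tw_3)\ge 11$, where $\mathrm{planar}\cap tw_3$ is the class of all planar graphs with treewidth at most $3$.
   Context: Graphs are finite, simple and undirected; a coloring of a graph is an assignment of colors to its vertices (not required to be proper unless stated). A square is a word of the form $uu$ with $u$ a nonempty word; its period is $|u|$, the length of $u$. A coloring of a graph $G$ contains a square of period $p$ if there is a (simple, not necessarily induced) path $v_1v_2\cdots v_{2p}$ in $G$, with distinct vertices and consecutive vertices adjacent, whose sequence of colors is a square of period $p$, i.e. $v_i$ and $v_{i+p}$ have the same color for all $1\le i\le p$. For an integer $k\ge 1$, $\pi_k(G)$ is the minimum number of colors needed to color $G$ such that no square of period at least $k$ appears in $G$. For a class $C$ of graphs, $\pi_k(C)$ is the supremum of $\pi_k(G)$ over all $G\in C$. The class $tw_3$ is the class of graphs with treewidth at most $3$. *)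

theory Defs
  imports
    "HOL-Analysis.Analysis"
    "HOL-Library.Extended_Nat"
    "Graph_Theory.Graph_Theory"
begin

text \<open>
  Finite simple undirected graphs are rendered by the locale \<^locale>\<open>pair_graph\<close> (finite,
  loop-free, symmetric); an undirected edge is a pair of opposite arcs.
\<close>


section \<open>Squares in colorings\<close>

definition square_of_period :: "nat \<Rightarrow> 'c list \<Rightarrow> bool" where
  "square_of_period p w \<longleftrightarrow> (\<exists>u. u \<noteq> [] \<and> length u = p \<and> w = u @ u)"

definition contains_square ::
  "'a pair_pre_digraph \<Rightarrow> ('a \<Rightarrow> 'c) \<Rightarrow> nat \<Rightarrow> bool" where
  "contains_square G c p \<longleftrightarrow>
     (\<exists>vs. vpath vs (with_proj G) \<and> square_of_period p (map c vs))"

text \<open>The coloring need not be proper.\<close>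

definition avoiding_colorable :: "nat \<Rightarrow> nat \<Rightarrow> 'a pair_pre_digraph \<Rightarrow> bool" where
  "avoiding_colorable k n G \<longleftrightarrow>
     (\<exists>c. c ` pverts G \<subseteq> {..<n} \<and> (\<forall>p\<ge>k. \<not> contains_square G c p))"

text \<open>
  The minimum below exists for every finite graph: a coloring that is injective on the vertices
  contains no square at all.
\<close>

definition pi_graph :: "nat \<Rightarrow> 'a pair_pre_digraph \<Rightarrow> nat" where
  "pi_graph k G = (LEAST n. avoiding_colorable k n G)"

definition pi_class :: "nat \<Rightarrow> 'a pair_pre_digraph set \<Rightarrow> enat" where
  "pi_class k C = (SUP G\<in>C. enat (pi_graph k G))"


section \<open>Planar graphs\<close>

text \<open>
  A drawing in the plane maps vertices injectively to points and edges to arcs joining their ends.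
  Arcs avoid all other vertices, and arcs of distinct edges meet only at (the images of) common
  ends. The two orientations of an edge are drawn as the same arc.
\<close>

definition plane_drawing ::
  "'a pair_pre_digraph \<Rightarrow> ('a \<Rightarrow> complex) \<Rightarrow> ('a \<times> 'a \<Rightarrow> real \<Rightarrow> complex) \<Rightarrow> bool" where
  "plane_drawing G pos \<gamma> \<longleftrightarrow>
     inj_on pos (pverts G) \<and>
     (\<forall>(u, v) \<in> parcs G.
        Path_Connected.arc (\<gamma> (u, v)) \<and> pathstart (\<gamma> (u, v)) = pos u \<and> pathfinish (\<gamma> (u, v)) = pos v \<and>
        \<gamma> (v, u) = reversepath (\<gamma> (u, v)) \<and>
        path_image (\<gamma> (u, v)) \<inter> pos ` pverts G = {pos u, pos v}) \<and>
     (\<forall>(u, v) \<in> parcs G. \<forall>(x, y) \<in> parcs G. {u, v} \<noteq> {x, y} \<longrightarrow>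
        path_image (\<gamma> (u, v)) \<inter> path_image (\<gamma> (x, y)) \<subseteq> pos ` ({u, v} \<inter> {x, y}))"

definition planar_graphs :: "'a pair_pre_digraph set" where
  "planar_graphs = {G. pair_graph G \<and> (\<exists>pos \<gamma>. plane_drawing G pos \<gamma>)}"


section \<open>Treewidth\<close>

text \<open>
  \<^const>\<open>Digraph_Component.tree\<close> is not suitable for symmetric digraphs, where the two arcs of an
  edge already form a cycle of length 2. In a \<^locale>\<open>pair_graph\<close>, the cycles of length at least 3
  are exactly the cycles of the undirected graph. Note that the library's notion of
  connectedness excludes the null graph.
\<close>

definition undirected_tree :: "'a pair_pre_digraph \<Rightarrow> bool" where
  "undirected_tree T \<longleftrightarrow>
     pair_graph T \<and> Digraph_Component.connected (with_proj T) \<and>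
     \<not> (\<exists>p. pre_digraph.cycle (with_proj T) p \<and> 3 \<le> length p)"

definition tree_decomposition ::
  "'a pair_pre_digraph \<Rightarrow> 't pair_pre_digraph \<Rightarrow> ('t \<Rightarrow> 'a set) \<Rightarrow> bool" where
  "tree_decomposition G T B \<longleftrightarrow>
     undirected_tree T \<and>
     (\<Union>t \<in> pverts T. B t) = pverts G \<and>
     (\<forall>(u, v) \<in> parcs G. \<exists>t \<in> pverts T. u \<in> B t \<and> v \<in> B t) \<and>
     (\<forall>v \<in> pverts G.
        Digraph_Component.connected (with_proj T \<restriction> {t \<in> pverts T. v \<in> B t}))"

definition decomposition_width :: "'t pair_pre_digraph \<Rightarrow> ('t \<Rightarrow> 'a set) \<Rightarrow> nat" where
  "decomposition_width T B = Max ((\<lambda>t. card (B t)) ` pverts T) - 1"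

text \<open>
  Every finite tree is isomorphic to one with natural numbers as nodes. For a finite graph the
  minimum exists, since one bag with all the vertices is a decomposition; truncated subtraction
  matters only for the null graph, which gets treewidth 0 here.
\<close>

definition treewidth :: "'a pair_pre_digraph \<Rightarrow> nat" where
  "treewidth G =
     (LEAST w. \<exists>(T :: nat pair_pre_digraph) B.
        tree_decomposition G T B \<and> decomposition_width T B = w)"

definition tw_graphs :: "nat \<Rightarrow> 'a pair_pre_digraph set" where
  "tw_graphs w = {G. pair_graph G \<and> treewidth G \<le> w}"

end

theory Submission
  imports Defs "HOL-Library.Diagonal_Subsequence"
begin

text \<open>
  The graphs are the Apollonian networks, obtained from a triangle by repeatedly inserting a vertex
  into every face. By compactness, 10-colorings of all of them would give one of the infinite
  network without squares of period at least \<open>k\<close>. There, every face with side \<open>pq\<close> contains an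
  infinite path, the fan of \<open>pq\<close>, all of whose vertices are adjacent to \<open>p\<close> and to \<open>q\<close>; every
  color pattern far out on a fan has occurred earlier on it. Two equally colored long pieces \<open>Q'\<close>,
  \<open>Q\<close> of a fan can be joined through \<open>q\<close>, so a path \<open>Q' q Q w\<close> shows that the color of \<open>q\<close> differs
  from that of every other neighbor \<open>w\<close> of the end of \<open>Q\<close>. Similarly, if the color of a neighbor
  \<open>t\<close> of a fan vertex \<open>x\<close> also occurs next to \<open>x\<close> on the fan, then the neighbors of \<open>t\<close> avoid
  the color of \<open>q\<close>. With these rules the fans around a vertex cannot all live on 5 colors. Now let
  \<open>x\<close> be a vertex on the fan of \<open>uv\<close> whose two neighbors on the fan have different colors \<open>d\<close> and
  \<open>e\<close>. If some deeper fan vertex at \<open>x\<close> is colored \<open>d\<close> or \<open>e\<close>, then its own fans avoid 5 of the 10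
  colors; otherwise the fans at \<open>x\<close> avoid \<open>d\<close>, \<open>e\<close> and the colors of \<open>u\<close>, \<open>v\<close>, \<open>x\<close>.
\<close>


section \<open>Apollonian networks\<close>

text \<open>
  The term \<open>Centre p q r\<close> is the vertex inserted into the face \<open>pqr\<close>, so vertices of different faces
  are different terms.
\<close>

datatype vertex = Root0 | Root1 | Root2 | Centre vertex vertex vertex

instance vertex :: countable
  by countable_datatype

fun faces :: "nat \<Rightarrow> (vertex \<times> vertex \<times> vertex) set" where
  "faces 0 = {(Root0, Root1, Root2)}"
| "faces (Suc n) = (\<Union>(p, q, r)\<in>faces n.
     {(p, q, Centre p q r), (q, r, Centre p q r), (p, r, Centre p q r)})"

fun nodes :: "nat \<Rightarrow> vertex set" where
  "nodes 0 = {Root0, Root1, Root2}"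
| "nodes (Suc n) = nodes n \<union> (\<lambda>(p, q, r). Centre p q r) ` faces n"

fun edges :: "nat \<Rightarrow> (vertex \<times> vertex) set" where
  "edges 0 = {(a, b). a \<noteq> b \<and> {a, b} \<subseteq> {Root0, Root1, Root2}}"
| "edges (Suc n) = edges n \<union>
     (\<Union>(p, q, r)\<in>faces n. \<Union>a\<in>{p, q, r}. {(Centre p q r, a), (a, Centre p q r)})"

lemma edges_sym: "(a, b) \<in> edges n \<Longrightarrow> (b, a) \<in> edges n"
  by (induction n) auto

definition face :: "vertex \<Rightarrow> vertex \<Rightarrow> vertex \<Rightarrow> bool" where
  "face p q r \<longleftrightarrow> (\<exists>n. (p, q, r) \<in> faces n)"

definition adj :: "vertex \<Rightarrow> vertex \<Rightarrow> bool" where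
  "adj a b \<longleftrightarrow> (\<exists>n. (a, b) \<in> edges n)"


section \<open>Straight-line drawings\<close>

definition bary :: "complex \<Rightarrow> complex \<Rightarrow> complex \<Rightarrow> real \<Rightarrow> real \<Rightarrow> real \<Rightarrow> complex" where
  "bary a b c x y z = x *\<^sub>R a + y *\<^sub>R b + z *\<^sub>R c"

definition nondegenerate :: "complex \<Rightarrow> complex \<Rightarrow> complex \<Rightarrow> bool" where
  "nondegenerate a b c \<longleftrightarrow>
     (\<forall>x y z. x + y + z = 0 \<longrightarrow> bary a b c x y z = 0 \<longrightarrow> x = 0 \<and> y = 0 \<and> z = 0)"

definition region ::
    "(real \<Rightarrow> real \<Rightarrow> real \<Rightarrow> bool) \<Rightarrow> complex \<Rightarrow> complex \<Rightarrow> complex \<Rightarrow> complex set" where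
  "region Q a b c = {bary a b c x y z |x y z. x + y + z = 1 \<and> Q x y z}"

abbreviation open_triangle :: "complex \<Rightarrow> complex \<Rightarrow> complex \<Rightarrow> complex set" where
  "open_triangle \<equiv> region (\<lambda>x y z. 0 < x \<and> 0 < y \<and> 0 < z)"

lemma bary_inject:
  assumes "nondegenerate a b c" "x + y + z = 1" "x' + y' + z' = 1"
    "bary a b c x y z = bary a b c x' y' z'"
  shows "x = x' \<and> y = y' \<and> z = z'"
proof -
  have "bary a b c (x - x') (y - y') (z - z') = 0"
    using assms(4) by (simp add: bary_def algebra_simps)
  moreover have "(x - x') + (y - y') + (z - z') = 0"
    using assms(2,3) by simp
  ultimately have "x - x' = 0 \<and> y - y' = 0 \<and> z - z' = 0"
    using assms(1) unfolding nondegenerate_def by blast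
  then show ?thesis by simp
qed

lemma region_disjoint:
  assumes "nondegenerate a b c"
    "\<And>x y z. \<lbrakk>x + y + z = 1; Q x y z; Q' x y z\<rbrakk> \<Longrightarrow> False"
  shows "region Q a b c \<inter> region Q' a b c = {}"
  using assms bary_inject[OF assms(1)] unfolding region_def by blast

lemma region_mono: "(\<And>x y z. x + y + z = 1 \<Longrightarrow> Q x y z \<Longrightarrow> Q' x y z) \<Longrightarrow> region Q a b c \<subseteq> region Q' a b c"
  unfolding region_def by blast

definition centroid :: "complex \<Rightarrow> complex \<Rightarrow> complex \<Rightarrow> complex" where
  "centroid a b c = (1 / 3) *\<^sub>R (a + b + c)"

lemma bary_centroid:
  "bary a b (centroid a b c) x y z = bary a b c (x + z / 3) (y + z / 3) (z / 3)"
  "bary b c (centroid a b c) x y z = bary a b c (z / 3) (x + z / 3) (y + z / 3)"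
  "bary a c (centroid a b c) x y z = bary a b c (x + z / 3) (z / 3) (y + z / 3)"
  by (simp_all add: bary_def centroid_def algebra_simps)

lemma nondegenerate_centroid:
  assumes "nondegenerate a b c"
  shows "nondegenerate a b (centroid a b c)" "nondegenerate b c (centroid a b c)"
    "nondegenerate a c (centroid a b c)"
proof -
  have *: "x = 0 \<and> y = 0 \<and> z = 0" if "x + y + z = 0" "bary a b c x y z = 0" for x y z
    using assms that unfolding nondegenerate_def by blast
  show "nondegenerate a b (centroid a b c)"
    unfolding nondegenerate_def bary_centroid
  proof (intro allI impI)
    fix x y z assume "x + y + z = 0" "bary a b c (x + z / 3) (y + z / 3) (z / 3) = 0"
    then show "x = 0 \<and> y = 0 \<and> z = 0"
      using *[of "x + z / 3" "y + z / 3" "z / 3"] by simp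
  qed
  show "nondegenerate b c (centroid a b c)"
    unfolding nondegenerate_def bary_centroid
  proof (intro allI impI)
    fix x y z assume "x + y + z = 0" "bary a b c (z / 3) (x + z / 3) (y + z / 3) = 0"
    then show "x = 0 \<and> y = 0 \<and> z = 0"
      using *[of "z / 3" "x + z / 3" "y + z / 3"] by simp
  qed
  show "nondegenerate a c (centroid a b c)"
    unfolding nondegenerate_def bary_centroid
  proof (intro allI impI)
    fix x y z assume "x + y + z = 0" "bary a b c (x + z / 3) (z / 3) (y + z / 3) = 0"
    then show "x = 0 \<and> y = 0 \<and> z = 0"
      using *[of "x + z / 3" "z / 3" "y + z / 3"] by simp
  qed
qed

lemma regionI: "\<lbrakk>t = bary a b c x y z; x + y + z = 1; Q x y z\<rbrakk> \<Longrightarrow> t \<in> region Q a b c"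
  unfolding region_def by blast

lemma triangle_centroid:
  "open_triangle a b (centroid a b c) \<subseteq> region (\<lambda>x y z. 0 < z \<and> z < x \<and> z < y) a b c"
  "open_triangle b c (centroid a b c) \<subseteq> region (\<lambda>x y z. 0 < x \<and> x < y \<and> x < z) a b c"
  "open_triangle a c (centroid a b c) \<subseteq> region (\<lambda>x y z. 0 < y \<and> y < x \<and> y < z) a b c"
proof -
  show "open_triangle a b (centroid a b c) \<subseteq> region (\<lambda>x y z. 0 < z \<and> z < x \<and> z < y) a b c"
  proof
    fix t assume "t \<in> open_triangle a b (centroid a b c)"
    then obtain x y z where "t = bary a b (centroid a b c) x y z" "x + y + z = 1" "0 < x" "0 < y" "0 < z"
      unfolding region_def by blast
    then show "t \<in> region (\<lambda>x y z. 0 < z \<and> z < x \<and> z < y) a b c"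
      by (intro regionI[where x = "x + z / 3" and y = "y + z / 3" and z = "z / 3"])
         (simp_all add: bary_centroid)
  qed
  show "open_triangle b c (centroid a b c) \<subseteq> region (\<lambda>x y z. 0 < x \<and> x < y \<and> x < z) a b c"
  proof
    fix t assume "t \<in> open_triangle b c (centroid a b c)"
    then obtain x y z where "t = bary b c (centroid a b c) x y z" "x + y + z = 1" "0 < x" "0 < y" "0 < z"
      unfolding region_def by blast
    then show "t \<in> region (\<lambda>x y z. 0 < x \<and> x < y \<and> x < z) a b c"
      by (intro regionI[where x = "z / 3" and y = "x + z / 3" and z = "y + z / 3"])
         (simp_all add: bary_centroid)
  qed
  show "open_triangle a c (centroid a b c) \<subseteq> region (\<lambda>x y z. 0 < y \<and> y < x \<and> y < z) a b c"
  proof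
    fix t assume "t \<in> open_triangle a c (centroid a b c)"
    then obtain x y z where "t = bary a c (centroid a b c) x y z" "x + y + z = 1" "0 < x" "0 < y" "0 < z"
      unfolding region_def by blast
    then show "t \<in> region (\<lambda>x y z. 0 < y \<and> y < x \<and> y < z) a b c"
      by (intro regionI[where x = "x + z / 3" and y = "z / 3" and z = "y + z / 3"])
         (simp_all add: bary_centroid)
  qed
qed

lemma in_segment_centroidE:
  assumes "t \<in> closed_segment (centroid a b c) e"
  obtains w u where "0 \<le> w" "0 \<le> u" "3 * w + u = 1" "t = w *\<^sub>R (a + b + c) + u *\<^sub>R e"
proof -
  obtain u where u: "t = (1 - u) *\<^sub>R centroid a b c + u *\<^sub>R e" "0 \<le> u" "u \<le> 1"
    using assms by (auto simp: in_segment)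
  show thesis
  proof (rule that)
    show "3 * ((1 - u) / 3) + u = 1"
      by (simp add: field_simps)
  qed (use u in \<open>auto simp: centroid_def\<close>)
qed

lemma segment_centroid:
  "closed_segment (centroid a b c) a \<subseteq> region (\<lambda>x y z. y = z \<and> z \<le> x) a b c"
  "closed_segment (centroid a b c) b \<subseteq> region (\<lambda>x y z. x = z \<and> z \<le> y) a b c"
  "closed_segment (centroid a b c) c \<subseteq> region (\<lambda>x y z. x = y \<and> y \<le> z) a b c"
proof -
  show "closed_segment (centroid a b c) a \<subseteq> region (\<lambda>x y z. y = z \<and> z \<le> x) a b c"
  proof
    fix t assume "t \<in> closed_segment (centroid a b c) a"
    then show "t \<in> region (\<lambda>x y z. y = z \<and> z \<le> x) a b c"
    proof (rule in_segment_centroidE)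
      fix w u assume "0 \<le> w" "0 \<le> u" "3 * w + u = 1" "t = w *\<^sub>R (a + b + c) + u *\<^sub>R a"
      then show ?thesis
        by (intro regionI[where x = "w + u" and y = w and z = w]) (simp_all add: bary_def algebra_simps)
    qed
  qed
  show "closed_segment (centroid a b c) b \<subseteq> region (\<lambda>x y z. x = z \<and> z \<le> y) a b c"
  proof
    fix t assume "t \<in> closed_segment (centroid a b c) b"
    then show "t \<in> region (\<lambda>x y z. x = z \<and> z \<le> y) a b c"
    proof (rule in_segment_centroidE)
      fix w u assume "0 \<le> w" "0 \<le> u" "3 * w + u = 1" "t = w *\<^sub>R (a + b + c) + u *\<^sub>R b"
      then show ?thesis
        by (intro regionI[where x = w and y = "w + u" and z = w]) (simp_all add: bary_def algebra_simps)
    qed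
  qed
  show "closed_segment (centroid a b c) c \<subseteq> region (\<lambda>x y z. x = y \<and> y \<le> z) a b c"
  proof
    fix t assume "t \<in> closed_segment (centroid a b c) c"
    then show "t \<in> region (\<lambda>x y z. x = y \<and> y \<le> z) a b c"
    proof (rule in_segment_centroidE)
      fix w u assume "0 \<le> w" "0 \<le> u" "3 * w + u = 1" "t = w *\<^sub>R (a + b + c) + u *\<^sub>R c"
      then show ?thesis
        by (intro regionI[where x = w and y = w and z = "w + u"]) (simp_all add: bary_def algebra_simps)
    qed
  qed
qed

lemma segment_centroid_inside:
  assumes "e \<in> {a, b, c}" "t \<in> closed_segment (centroid a b c) e"
  shows "t = e \<or> t \<in> open_triangle a b c"
  using assms(2)
proof (rule in_segment_centroidE)
  fix w u assume wu: "0 \<le> w" "0 \<le> u" "3 * w + u = 1" and t: "t = w *\<^sub>R (a + b + c) + u *\<^sub>R e"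
  show ?thesis
  proof (cases "w = 0")
    case True
    then show ?thesis using wu t by simp
  next
    case False
    then have w: "0 < w" using wu by simp
    from assms(1) consider "e = a" | "e = b" | "e = c" by auto
    then have "t \<in> open_triangle a b c"
    proof cases
      case 1
      then show ?thesis
        using wu w t by (intro regionI[where x = "w + u" and y = w and z = w]) (simp_all add: bary_def algebra_simps)
    next
      case 2
      then show ?thesis
        using wu w t by (intro regionI[where x = w and y = "w + u" and z = w]) (simp_all add: bary_def algebra_simps)
    next
      case 3
      then show ?thesis
        using wu w t by (intro regionI[where x = w and y = w and z = "w + u"]) (simp_all add: bary_def algebra_simps)
    qed
    then show ?thesis ..
  qed
qed

lemma centroid_in_triangle: "centroid a b c \<in> open_triangle a b c"
  by (rule regionI[where x = "1 / 3" and y = "1 / 3" and z = "1 / 3"])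
     (simp_all add: bary_def centroid_def algebra_simps)

definition children :: "complex \<Rightarrow> complex \<Rightarrow> complex \<Rightarrow> (complex \<times> complex \<times> complex) set" where
  "children a b c = {(a, b, centroid a b c), (b, c, centroid a b c), (a, c, centroid a b c)}"

lemma child_triangle_subset:
  assumes "(p, q, r) \<in> children a b c"
  shows "open_triangle p q r \<subseteq> open_triangle a b c"
proof -
  have "region (\<lambda>x y z. 0 < z \<and> z < x \<and> z < y) a b c \<subseteq> open_triangle a b c"
    "region (\<lambda>x y z. 0 < x \<and> x < y \<and> x < z) a b c \<subseteq> open_triangle a b c"
    "region (\<lambda>x y z. 0 < y \<and> y < x \<and> y < z) a b c \<subseteq> open_triangle a b c"
    by (rule region_mono, linarith)+
  then show ?thesis
    using assms triangle_centroid[where a = a and b = b and c = c] unfolding children_def by blast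
qed

lemma child_triangles_disjoint:
  assumes "nondegenerate a b c"
  shows "open_triangle a b (centroid a b c) \<inter> open_triangle b c (centroid a b c) = {}"
    "open_triangle a b (centroid a b c) \<inter> open_triangle a c (centroid a b c) = {}"
    "open_triangle b c (centroid a b c) \<inter> open_triangle a c (centroid a b c) = {}"
proof -
  have "region (\<lambda>x y z. 0 < z \<and> z < x \<and> z < y) a b c \<inter> region (\<lambda>x y z. 0 < x \<and> x < y \<and> x < z) a b c = {}"
    "region (\<lambda>x y z. 0 < z \<and> z < x \<and> z < y) a b c \<inter> region (\<lambda>x y z. 0 < y \<and> y < x \<and> y < z) a b c = {}"
    "region (\<lambda>x y z. 0 < x \<and> x < y \<and> x < z) a b c \<inter> region (\<lambda>x y z. 0 < y \<and> y < x \<and> y < z) a b c = {}"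
    by (rule region_disjoint[OF assms], linarith)+
  then show "open_triangle a b (centroid a b c) \<inter> open_triangle b c (centroid a b c) = {}"
    "open_triangle a b (centroid a b c) \<inter> open_triangle a c (centroid a b c) = {}"
    "open_triangle b c (centroid a b c) \<inter> open_triangle a c (centroid a b c) = {}"
    using triangle_centroid[where a = a and b = b and c = c] by blast+
qed

lemma segment_centroid_child_triangle:
  assumes "nondegenerate a b c" "(p, q, r) \<in> children a b c" "e \<in> {a, b, c}"
  shows "closed_segment (centroid a b c) e \<inter> open_triangle p q r = {}"
proof -
  let ?S = "[\<lambda>x y z. y = z \<and> z \<le> x, \<lambda>x y z. x = z \<and> z \<le> y, \<lambda>x y z. x = y \<and> y \<le> z]"
  let ?T = "[\<lambda>x y z. 0 < z \<and> z < x \<and> z < y, \<lambda>x y z. 0 < x \<and> x < y \<and> x < z, \<lambda>x y z. 0 < y \<and> y < x \<and> y < z]"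
  have "\<exists>S\<in>set ?S. closed_segment (centroid a b c) e \<subseteq> region S a b c"
    using assms(3) segment_centroid[where a = a and b = b and c = c] by auto
  then obtain S where S: "S \<in> set ?S" "closed_segment (centroid a b c) e \<subseteq> region S a b c"
    by blast
  have "\<exists>T\<in>set ?T. open_triangle p q r \<subseteq> region T a b c"
    using assms(2) triangle_centroid[where a = a and b = b and c = c] by (auto simp: children_def)
  then obtain T where T: "T \<in> set ?T" "open_triangle p q r \<subseteq> region T a b c"
    by blast
  have "region S a b c \<inter> region T a b c = {}"
    by (rule region_disjoint[OF assms(1)]) (use S(1) T(1) in auto)
  then show ?thesis
    using S(2) T(2) by blast
qed

lemma segments_centroid:
  assumes "nondegenerate a b c" "e \<in> {a, b, c}" "e' \<in> {a, b, c}" "e \<noteq> e'"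
  shows "closed_segment (centroid a b c) e \<inter> closed_segment (centroid a b c) e' \<subseteq> {centroid a b c}"
proof
  fix t assume t: "t \<in> closed_segment (centroid a b c) e \<inter> closed_segment (centroid a b c) e'"
  have *: "t = centroid a b c"
    if S: "t \<in> region S a b c" "t \<in> region S' a b c"
      and eq: "\<And>x y z. S x y z \<Longrightarrow> S' x y z \<Longrightarrow> x = y \<and> y = z" for S S'
  proof -
    obtain x y z where xyz: "t = bary a b c x y z" "x + y + z = 1" "S x y z"
      using S(1) unfolding region_def by blast
    moreover have "S' x y z"
      using S(2) xyz(1,2) bary_inject[OF assms(1)] unfolding region_def by blast
    ultimately have third: "x = 1 / 3" "y = 1 / 3" "z = 1 / 3"
      using eq[of x y z] by auto
    show ?thesis
      unfolding xyz(1) bary_def centroid_def third by (simp add: scaleR_add_right)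
  qed
  consider "t \<in> region (\<lambda>x y z. y = z \<and> z \<le> x) a b c" "t \<in> region (\<lambda>x y z. x = z \<and> z \<le> y) a b c"
    | "t \<in> region (\<lambda>x y z. y = z \<and> z \<le> x) a b c" "t \<in> region (\<lambda>x y z. x = y \<and> y \<le> z) a b c"
    | "t \<in> region (\<lambda>x y z. x = z \<and> z \<le> y) a b c" "t \<in> region (\<lambda>x y z. x = y \<and> y \<le> z) a b c"
    using t assms(2-4) segment_centroid[where a = a and b = b and c = c] by blast
  then have "t = centroid a b c"
  proof cases
    case 1
    then show ?thesis by (rule *) auto
  next
    case 2
    then show ?thesis by (rule *) auto
  next
    case 3
    then show ?thesis by (rule *) auto
  qed
  then show "t \<in> {centroid a b c}"
    by simp
qed

fun pos :: "vertex \<Rightarrow> complex" where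
  "pos Root0 = 0"
| "pos Root1 = 1"
| "pos Root2 = \<i>"
| "pos (Centre p q r) = centroid (pos p) (pos q) (pos r)"

definition inside :: "vertex \<times> vertex \<times> vertex \<Rightarrow> complex set" where
  "inside f = (case f of (p, q, r) \<Rightarrow> open_triangle (pos p) (pos q) (pos r))"

abbreviation segment :: "vertex \<Rightarrow> vertex \<Rightarrow> complex set" where
  "segment a b \<equiv> closed_segment (pos a) (pos b)"

lemma faces_nodes: "(p, q, r) \<in> faces n \<Longrightarrow> {p, q, r} \<subseteq> nodes n"
proof (induction n arbitrary: p q r)
  case (Suc n)
  obtain a b c where abc: "(a, b, c) \<in> faces n"
    "(p, q, r) \<in> {(a, b, Centre a b c), (b, c, Centre a b c), (a, c, Centre a b c)}"
    using Suc.prems by auto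
  moreover have "{a, b, c} \<subseteq> nodes n"
    by (rule Suc.IH[OF abc(1)])
  moreover have "Centre a b c \<in> nodes (Suc n)" "nodes n \<subseteq> nodes (Suc n)"
    using abc(1) by force+
  ultimately show ?case
    by (auto simp del: nodes.simps)
qed simp

lemma edges_SucE:
  assumes "(u, v) \<in> edges (Suc n)"
  obtains "(u, v) \<in> edges n"
  | p q r a where "(p, q, r) \<in> faces n" "a \<in> {p, q, r}" "{u, v} = {Centre p q r, a}"
      "segment u v = segment (Centre p q r) a"
proof -
  consider "(u, v) \<in> edges n" | p q r a where "(p, q, r) \<in> faces n" "a \<in> {p, q, r}"
    "(u, v) \<in> {(Centre p q r, a), (a, Centre p q r)}"
    using assms by (simp only: edges.simps Un_iff UN_iff case_prod_unfold) (metis prod.collapse)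
  then show thesis
  proof cases
    case 2
    show thesis
      by (rule that(2)[OF 2(1,2)]) (use 2(3) in \<open>auto simp: closed_segment_commute\<close>)
  qed (use that in blast)
qed

lemma edges_nodes: "(u, v) \<in> edges n \<Longrightarrow> {u, v} \<subseteq> nodes n"
proof (induction n)
  case (Suc n)
  from Suc.prems show ?case
  proof (cases rule: edges_SucE)
    case 1
    then show ?thesis using Suc.IH by auto
  next
    case (2 p q r a)
    have "Centre p q r \<in> nodes (Suc n)"
      using 2(1) by force
    moreover have "a \<in> nodes (Suc n)"
      using faces_nodes[OF 2(1)] 2(2) by auto
    ultimately show ?thesis
      unfolding 2(3) by (simp only: insert_subset empty_subsetI simp_thms)
  qed
qed auto

lemma nodes_SucE:
  assumes "w \<in> nodes (Suc n)"
  obtains "w \<in> nodes n" | p q r where "(p, q, r) \<in> faces n" "w = Centre p q r"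
  using assms by auto

lemma inside_child:
  assumes "g \<in> {(p, q, Centre p q r), (q, r, Centre p q r), (p, r, Centre p q r)}"
  shows "inside g \<subseteq> inside (p, q, r)"
proof -
  obtain a b c where g: "g = (a, b, c)"
    by (cases g)
  have "(pos a, pos b, pos c) \<in> children (pos p) (pos q) (pos r)"
    using assms by (auto simp: g children_def)
  then show ?thesis
    unfolding inside_def g prod.case by (rule child_triangle_subset)
qed

lemma faces_SucE:
  assumes "g \<in> faces (Suc n)"
  obtains p q r where "(p, q, r) \<in> faces n"
    "g \<in> {(p, q, Centre p q r), (q, r, Centre p q r), (p, r, Centre p q r)}"
  using assms by auto

text \<open>The invariant keeps the open triangles of the current faces clear of everything drawn so far.\<close>

definition drawn :: "nat \<Rightarrow> bool" where
  "drawn n \<longleftrightarrow>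
    (\<forall>(p, q, r)\<in>faces n. nondegenerate (pos p) (pos q) (pos r)) \<and>
    (\<forall>f\<in>faces n. \<forall>g\<in>faces n. f \<noteq> g \<longrightarrow> inside f \<inter> inside g = {}) \<and>
    (\<forall>f\<in>faces n. \<forall>w\<in>nodes n. pos w \<notin> inside f) \<and>
    (\<forall>f\<in>faces n. \<forall>(u, v)\<in>edges n. segment u v \<inter> inside f = {}) \<and>
    inj_on pos (nodes n) \<and>
    (\<forall>(u, v)\<in>edges n. \<forall>w\<in>nodes n. pos w \<in> segment u v \<longrightarrow> w \<in> {u, v}) \<and>
    (\<forall>(u, v)\<in>edges n. \<forall>(x, y)\<in>edges n. {u, v} \<noteq> {x, y} \<longrightarrow>
      segment u v \<inter> segment x y \<subseteq> pos ` ({u, v} \<inter> {x, y}))"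

lemma drawn_0: "drawn 0"
proof -
  have nd: "nondegenerate 0 1 \<i>"
    by (auto simp: nondegenerate_def bary_def complex_eq_iff)
  have in_T: "t \<in> inside (Root0, Root1, Root2) \<Longrightarrow> 0 < Re t \<and> 0 < Im t \<and> Re t + Im t < 1" for t
    by (auto simp: inside_def region_def bary_def)
  have seg: "t \<in> closed_segment 0 1 \<Longrightarrow> Im t = 0" "t \<in> closed_segment 0 \<i> \<Longrightarrow> Re t = 0"
    "t \<in> closed_segment 1 \<i> \<Longrightarrow> Re t + Im t = 1"
    "t \<in> closed_segment 1 0 \<Longrightarrow> Im t = 0" "t \<in> closed_segment \<i> 0 \<Longrightarrow> Re t = 0"
    "t \<in> closed_segment \<i> 1 \<Longrightarrow> Re t + Im t = 1" for t
    by (auto simp: in_segment)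
  have E: "(u, v) \<in> edges 0 \<longleftrightarrow> (u, v) \<in> {(Root0, Root1), (Root1, Root0), (Root0, Root2), (Root2, Root0),
      (Root1, Root2), (Root2, Root1)}" for u v
    by auto
  show ?thesis
    unfolding drawn_def
  proof (intro conjI)
    show "\<forall>(p, q, r)\<in>faces 0. nondegenerate (pos p) (pos q) (pos r)"
      using nd by simp
    show "\<forall>f\<in>faces 0. \<forall>g\<in>faces 0. f \<noteq> g \<longrightarrow> inside f \<inter> inside g = {}"
      by simp
    have "pos w \<notin> inside (Root0, Root1, Root2)" if "w \<in> nodes 0" for w
      using that in_T[of "pos w"] by auto
    then show "\<forall>f\<in>faces 0. \<forall>w\<in>nodes 0. pos w \<notin> inside f"
      by simp
    have "t \<notin> inside (Root0, Root1, Root2)" if "(u, v) \<in> edges 0" "t \<in> segment u v" for u v t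
      using that in_T[of t] seg[of t] unfolding E by auto
    then show "\<forall>f\<in>faces 0. \<forall>(u, v)\<in>edges 0. segment u v \<inter> inside f = {}"
      by (auto simp del: edges.simps)
    show "inj_on pos (nodes 0)"
      by (auto simp: inj_on_def complex_eq_iff)
    have avoid: "w \<in> {u, v}" if "(u, v) \<in> edges 0" "w \<in> nodes 0" "pos w \<in> segment u v" for u v w
      using that seg[of "pos w"] unfolding E by auto
    show "\<forall>(u, v)\<in>edges 0. \<forall>w\<in>nodes 0. pos w \<in> segment u v \<longrightarrow> w \<in> {u, v}"
      by (intro ballI, simp only: split_paired_all prod.case, intro ballI impI, rule avoid)
    have cross: "t \<in> pos ` ({u, v} \<inter> {x, y})"
      if "(u, v) \<in> edges 0" "(x, y) \<in> edges 0" "{u, v} \<noteq> {x, y}"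
        "t \<in> segment u v" "t \<in> segment x y" for u v x y t
    proof -
      have "\<exists>w. w \<in> {u, v} \<and> w \<in> {x, y} \<and> Re t = Re (pos w) \<and> Im t = Im (pos w)"
        using that seg[of t] unfolding E by auto
      then show ?thesis
        by (auto simp: complex_eq_iff)
    qed
    show "\<forall>(u, v)\<in>edges 0. \<forall>(x, y)\<in>edges 0. {u, v} \<noteq> {x, y} \<longrightarrow>
      segment u v \<inter> segment x y \<subseteq> pos ` ({u, v} \<inter> {x, y})"
      by (intro ballI, simp only: split_paired_all prod.case, intro ballI,
          simp only: split_paired_all prod.case, intro impI subsetI, elim IntE, rule cross)
  qed
qed

lemma drawn_Suc:
  assumes "drawn n"
  shows "drawn (Suc n)"
proof -
  note D = assms[unfolded drawn_def]
  have nd: "nondegenerate (pos p) (pos q) (pos r)" if "(p, q, r) \<in> faces n" for p q r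
    using D[THEN conjunct1] that by auto
  note D = D[THEN conjunct2]
  have disj: "f = g" if "f \<in> faces n" "g \<in> faces n" "t \<in> inside f" "t \<in> inside g" for f g t
    using D[THEN conjunct1] that by blast
  note D = D[THEN conjunct2]
  have clear: "pos w \<notin> inside f" if "f \<in> faces n" "w \<in> nodes n" for f w
    using D[THEN conjunct1] that by blast
  note D = D[THEN conjunct2]
  have clearE: "t \<notin> inside f" if "f \<in> faces n" "(u, v) \<in> edges n" "t \<in> segment u v" for f u v t
    using D[THEN conjunct1] that by blast
  note D = D[THEN conjunct2]
  have inj: "w = w'" if "w \<in> nodes n" "w' \<in> nodes n" "pos w = pos w'" for w w'
    by (rule inj_onD[OF D[THEN conjunct1] that(3,1,2)])
  note D = D[THEN conjunct2]
  have avoid: "w \<in> {u, v}" if "(u, v) \<in> edges n" "w \<in> nodes n" "pos w \<in> segment u v" for u v w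
    using D[THEN conjunct1] that by blast
  note D = D[THEN conjunct2]
  have cross: "t \<in> pos ` ({u, v} \<inter> {x, y})"
    if "(u, v) \<in> edges n" "(x, y) \<in> edges n" "{u, v} \<noteq> {x, y}" "t \<in> segment u v" "t \<in> segment x y" for u v x y t
    using bspec[OF bspec[OF D that(1), unfolded prod.case] that(2)] that(3-5) by blast
  have centre: "pos (Centre p q r) \<in> inside (p, q, r)" for p q r
    by (simp add: inside_def centroid_in_triangle)
  have spoke: "t = pos a \<or> t \<in> inside (p, q, r)"
    if "a \<in> {p, q, r}" "t \<in> segment (Centre p q r) a" for p q r a t
    unfolding inside_def prod.case
    by (rule segment_centroid_inside) (use that in auto)
  have old: "a \<in> nodes n" if "(p, q, r) \<in> faces n" "a \<in> {p, q, r}" for p q r a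
    using faces_nodes[OF that(1)] that(2) by blast

  have 1: "nondegenerate (pos a) (pos b) (pos c)" if "(a, b, c) \<in> faces (Suc n)" for a b c
    using that
  proof (cases rule: faces_SucE)
    case (1 p q r)
    then show ?thesis
      using nondegenerate_centroid[OF nd[OF 1(1)]] by auto
  qed
  have 2: "f = g" if "f \<in> faces (Suc n)" "g \<in> faces (Suc n)" "t \<in> inside f" "t \<in> inside g" for f g t
    using that(1)
  proof (cases rule: faces_SucE)
    case f: (1 p q r)
    from that(2) show ?thesis
    proof (cases rule: faces_SucE)
      case g: (1 p' q' r')
      have same: "(p, q, r) = (p', q', r')"
        using disj[OF f(1) g(1)] inside_child[OF f(2)] inside_child[OF g(2)] that(3,4) by blast
      show ?thesis
        using f(2) g(2) that(3,4) child_triangles_disjoint[OF nd[OF f(1)]] same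
        by (auto simp: inside_def)
    qed
  qed
  have 3: "pos w \<notin> inside g" if "g \<in> faces (Suc n)" "w \<in> nodes (Suc n)" for g w
    using that(1)
  proof (cases rule: faces_SucE)
    case g: (1 p q r)
    from that(2) show ?thesis
    proof (cases rule: nodes_SucE)
      case 1
      then show ?thesis
        using clear[OF g(1)] inside_child[OF g(2)] by blast
    next
      case w: (2 p' q' r')
      show ?thesis
      proof
        assume in_g: "pos w \<in> inside g"
        then have "(p, q, r) = (p', q', r')"
          using disj[OF g(1) w(1)] inside_child[OF g(2)] centre w(2) by blast
        moreover have "pos w \<in> closed_segment (centroid (pos p) (pos q) (pos r)) (pos p)"
          using calculation w(2) by simp
        moreover obtain a b c where abc: "g = (a, b, c)"
          by (cases g)
        moreover have "(pos a, pos b, pos c) \<in> children (pos p) (pos q) (pos r)"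
          using g(2) abc by (auto simp: children_def)
        ultimately show False
          using segment_centroid_child_triangle[OF nd[OF g(1)], of "pos a" "pos b" "pos c" "pos p"] in_g
          by (auto simp: inside_def)
      qed
    qed
  qed
  have 4: "t \<notin> inside g" if "g \<in> faces (Suc n)" "(u, v) \<in> edges (Suc n)" "t \<in> segment u v" for g u v t
    using that(1)
  proof (cases rule: faces_SucE)
    case g: (1 p q r)
    from that(2) show ?thesis
    proof (cases rule: edges_SucE)
      case 1
      then show ?thesis
        using clearE[OF g(1)] inside_child[OF g(2)] that(3) by blast
    next
      case e: (2 p' q' r' a)
      show ?thesis
      proof
        assume in_g: "t \<in> inside g"
        then have in_f: "t \<in> inside (p, q, r)"
          using inside_child[OF g(2)] by blast
        have t: "t \<in> segment (Centre p' q' r') a"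
          using that(3)[unfolded e(4)] .
        have "t \<noteq> pos a"
          using in_f clear[OF g(1) old[OF e(1,2)]] by blast
        then have same: "(p, q, r) = (p', q', r')"
          using spoke[OF e(2) t] disj[OF g(1) e(1) in_f] by blast
        obtain a' b c where abc: "g = (a', b, c)"
          by (cases g)
        have "(pos a', pos b, pos c) \<in> children (pos p) (pos q) (pos r)"
          using g(2) abc by (auto simp: children_def)
        then show False
          using segment_centroid_child_triangle[OF nd[OF g(1)], of "pos a'" "pos b" "pos c" "pos a"]
            in_g t e(2) same abc by (auto simp: inside_def)
      qed
    qed
  qed
  have 5: "w = w'" if "w \<in> nodes (Suc n)" "w' \<in> nodes (Suc n)" "pos w = pos w'" for w w'
    using that(1)
  proof (cases rule: nodes_SucE)
    case w: 1
    from that(2) show ?thesis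
    proof (cases rule: nodes_SucE)
      case 1
      then show ?thesis using inj w that(3) by blast
    next
      case 2
      then show ?thesis using clear[OF 2(1) w] centre that(3) by auto
    qed
  next
    case w: (2 p q r)
    from that(2) show ?thesis
    proof (cases rule: nodes_SucE)
      case 1
      then show ?thesis using clear[OF w(1) 1] centre[of p q r] w(2) that(3) by auto
    next
      case (2 p' q' r')
      then show ?thesis
        using disj[OF w(1) 2(1), of "pos w"] centre[of p q r] centre[of p' q' r'] w(2) that(3) by auto
    qed
  qed
  have 6: "w \<in> {u, v}" if "(u, v) \<in> edges (Suc n)" "w \<in> nodes (Suc n)" "pos w \<in> segment u v" for u v w
    using that(1)
  proof (cases rule: edges_SucE)
    case e: 1
    from that(2) show ?thesis
    proof (cases rule: nodes_SucE)
      case 1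
      then show ?thesis using avoid e that(3) by blast
    next
      case (2 p q r)
      then show ?thesis using clearE[OF 2(1) e that(3)] centre[of p q r] by simp
    qed
  next
    case e: (2 p q r a)
    have t: "pos w = pos a \<or> pos w \<in> inside (p, q, r)"
      using spoke[OF e(2) that(3)[unfolded e(4)]] .
    from that(2) have "w = a \<or> w = Centre p q r"
    proof (cases rule: nodes_SucE)
      case 1
      then show ?thesis
        using t clear[OF e(1) 1] inj[OF 1 old[OF e(1,2)]] by blast
    next
      case (2 p' q' r')
      have "pos w \<noteq> pos a"
        using clear[OF 2(1) old[OF e(1,2)]] centre[of p' q' r'] 2(2) by auto
      then show ?thesis
        using t disj[OF e(1) 2(1), of "pos w"] centre[of p' q' r'] 2(2) by auto
    qed
    then show ?thesis
      using e(3) by blast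
  qed
  have old_new: "t \<in> pos ` ({u, v} \<inter> {Centre p q r, a})"
    if "(u, v) \<in> edges n" "(p, q, r) \<in> faces n" "a \<in> {p, q, r}" "t \<in> segment u v"
      "t \<in> segment (Centre p q r) a" for u v p q r a t
  proof -
    have "t = pos a"
      using spoke[OF that(3,5)] clearE[OF that(2,1,4)] by blast
    moreover then have "a \<in> {u, v}"
      using avoid[OF that(1) old[OF that(2,3)]] that(4) by blast
    ultimately show ?thesis by blast
  qed
  have 7: "t \<in> pos ` ({u, v} \<inter> {x, y})"
    if "(u, v) \<in> edges (Suc n)" "(x, y) \<in> edges (Suc n)" "{u, v} \<noteq> {x, y}" "t \<in> segment u v" "t \<in> segment x y" for u v x y t
    using that(1)
  proof (cases rule: edges_SucE)
    case e: 1
    from that(2) show ?thesis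
    proof (cases rule: edges_SucE)
      case 1
      then show ?thesis using cross e that(3-5) by blast
    next
      case (2 p q r a)
      show ?thesis
        unfolding 2(3) by (rule old_new[OF e 2(1,2) that(4) that(5)[unfolded 2(4)]])
    qed
  next
    case e: (2 p q r a)
    from that(2) show ?thesis
    proof (cases rule: edges_SucE)
      case 1
      show ?thesis
        unfolding e(3) by (subst Int_commute) (rule old_new[OF 1 e(1,2) that(5) that(4)[unfolded e(4)]])
    next
      case e': (2 p' q' r' a')
      have t: "t \<in> segment (Centre p q r) a" "t \<in> segment (Centre p' q' r') a'"
        using that(4)[unfolded e(4)] that(5)[unfolded e'(4)] .
      note a = old[OF e(1,2)] and a' = old[OF e'(1,2)]
      have "t = pos (Centre p q r) \<and> Centre p q r = Centre p' q' r' \<or> t = pos a \<and> a = a'"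
      proof (cases "(p, q, r) = (p', q', r')")
        case True
        then have "a \<noteq> a'"
          using that(3) e(3) e'(3) by auto
        then have "pos a \<noteq> pos a'"
          using inj[OF a a'] by blast
        then show ?thesis
          using segments_centroid[OF nd[OF e(1)], of "pos a" "pos a'"] t True e(2) e'(2) by auto
      next
        case False
        then show ?thesis
          using spoke[OF e(2) t(1)] spoke[OF e'(2) t(2)] disj[OF e(1) e'(1), of t]
            clear[OF e(1) a'] clear[OF e'(1) a] inj[OF a a'] by auto
      qed
      then show ?thesis
        unfolding e(3) e'(3) by blast
    qed
  qed
  show ?thesis
    unfolding drawn_def
  proof (intro conjI)
    show "\<forall>(p, q, r)\<in>faces (Suc n). nondegenerate (pos p) (pos q) (pos r)"
      by (rule ballI, simp only: split_paired_all prod.case, rule 1)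
    show "\<forall>f\<in>faces (Suc n). \<forall>g\<in>faces (Suc n). f \<noteq> g \<longrightarrow> inside f \<inter> inside g = {}"
      using 2 by blast
    show "\<forall>f\<in>faces (Suc n). \<forall>w\<in>nodes (Suc n). pos w \<notin> inside f"
      by (intro ballI, rule 3)
    show "\<forall>f\<in>faces (Suc n). \<forall>(u, v)\<in>edges (Suc n). segment u v \<inter> inside f = {}"
      by (intro ballI, simp only: split_paired_all prod.case, rule equals0I, elim IntE, drule (2) 4, erule (1) notE)
    show "inj_on pos (nodes (Suc n))"
      by (rule inj_onI, rule 5)
    show "\<forall>(u, v)\<in>edges (Suc n). \<forall>w\<in>nodes (Suc n). pos w \<in> segment u v \<longrightarrow> w \<in> {u, v}"
      by (intro ballI, simp only: split_paired_all prod.case, intro ballI impI, rule 6)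
    show "\<forall>(u, v)\<in>edges (Suc n). \<forall>(x, y)\<in>edges (Suc n). {u, v} \<noteq> {x, y} \<longrightarrow>
      segment u v \<inter> segment x y \<subseteq> pos ` ({u, v} \<inter> {x, y})"
      by (intro ballI, simp only: split_paired_all prod.case, intro ballI,
          simp only: split_paired_all prod.case, intro impI subsetI, elim IntE, rule 7)
  qed
qed

lemma drawn: "drawn n"
  by (induction n) (auto intro: drawn_0 drawn_Suc)


section \<open>Tree decompositions\<close>

definition encode :: "vertex set \<Rightarrow> (vertex \<times> vertex) set \<Rightarrow> nat pair_pre_digraph" where
  "encode V E = \<lparr>pverts = to_nat ` V, parcs = map_prod to_nat to_nat ` E\<rparr>"

lemma encode_simps [simp]:
  "pverts (encode V E) = to_nat ` V" "parcs (encode V E) = map_prod to_nat to_nat ` E"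
  by (simp_all add: encode_def)

lemma pair_graph_encode:
  assumes "finite V" "E \<subseteq> V \<times> V" "sym E" "irrefl E"
  shows "pair_graph (encode V E)"
proof
  have "finite E"
    using assms(1,2) finite_subset by blast
  then show "finite (parcs (encode V E))" by simp
  show "finite (pverts (encode V E))"
    using assms(1) by simp
  show "symmetric (encode V E)"
    using assms(3) unfolding symmetric_def sym_def by auto
  fix e assume "e \<in> parcs (encode V E)"
  then show "fst e \<in> pverts (encode V E)" "snd e \<in> pverts (encode V E)" "fst e \<noteq> snd e"
    using assms(2,4) by (auto simp: irrefl_def)
qed

lemma connected_if_rooted:
  fixes H :: "('a, 'b) pre_digraph" and rank :: "'a \<Rightarrow> nat"
  assumes base: "base \<in> verts H"
    and up: "\<And>t. \<lbrakk>t \<in> verts H; t \<noteq> base\<rbrakk> \<Longrightarrow>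
      f t \<in> verts H \<and> rank (f t) < rank t \<and> (t, f t) \<in> arcs_ends H"
  shows "Digraph_Component.connected H"
proof -
  let ?A = "parcs (mk_symmetric H)"
  have both: "(t, f t) \<in> ?A" "(f t, t) \<in> ?A" if "t \<in> verts H" "t \<noteq> base" for t
    using up[OF that] by (auto simp: parcs_mk_symmetric arcs_ends_conv)
  have to_root: "(t, base) \<in> rtrancl_on (verts H) ?A \<and> (base, t) \<in> rtrancl_on (verts H) ?A"
    if "t \<in> verts H" for t
    using that
  proof (induction "rank t" arbitrary: t rule: less_induct)
    case less
    show ?case
    proof (cases "t = base")
      case False
      then have "(f t, base) \<in> rtrancl_on (verts H) ?A" "(base, f t) \<in> rtrancl_on (verts H) ?A"
        using less up by blast+
      then show ?thesis
        using both[OF less.prems False] less.prems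
        by (blast intro: converse_rtrancl_on_into_rtrancl_on rtrancl_on_into_rtrancl_on)
    qed (use base in auto)
  qed
  show ?thesis
    unfolding Digraph_Component.connected_def
  proof (rule strongly_connectedI)
    show "verts (with_proj (mk_symmetric H)) \<noteq> {}"
      using base by auto
    fix u v assume "u \<in> verts (with_proj (mk_symmetric H))" "v \<in> verts (with_proj (mk_symmetric H))"
    then show "u \<rightarrow>\<^sup>*\<^bsub>with_proj (mk_symmetric H)\<^esub> v"
      using to_root[of u] to_root[of v] unfolding reachable_def by (auto intro: rtrancl_on_trans)
  qed
qed

lemma pcas_nth:
  assumes "pcas u p v"
  shows "Suc i < length p \<Longrightarrow> fst (p ! Suc i) = snd (p ! i)"
    and "p \<noteq> [] \<Longrightarrow> fst (p ! 0) = u \<and> snd (last p) = v"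
  using assms
proof (induction p arbitrary: u i)
  case (Cons e p)
  {
    case 1
    then show ?case
      using Cons.IH(1)[of "i - 1" "snd e"] Cons.IH(2)[of "snd e"] by (cases i) auto
  next
    case 2
    then show ?case
      using Cons.IH(2)[of "snd e"] by auto
  }
qed auto

lemma pawalk_verts_tl: "pcas u p v \<Longrightarrow> tl (pawalk_verts u p) = map snd p"
proof -
  have "pcas u p v \<Longrightarrow> pawalk_verts u p = u # map snd p"
    by (induction p arbitrary: u) auto
  then show "pcas u p v \<Longrightarrow> tl (pawalk_verts u p) = map snd p"
    by simp
qed

lemma no_cycle_if_ranked:
  fixes H :: "'a pair_pre_digraph" and rank :: "'a \<Rightarrow> nat"
  assumes arcs: "\<And>x y. (x, y) \<in> parcs H \<Longrightarrow> y = f x \<and> rank y < rank x \<or> x = f y \<and> rank x < rank y"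
  shows "\<not> (\<exists>p. pre_digraph.cycle (with_proj H) p \<and> 3 \<le> length p)"
proof
  assume "\<exists>p. pre_digraph.cycle (with_proj H) p \<and> 3 \<le> length p"
  then obtain p u where p: "3 \<le> length p" "pcas u p u" "set p \<subseteq> parcs H" "distinct (map snd p)"
    unfolding pre_digraph.cycle_def pre_digraph.awalk_def cas_with_proj_eq awalk_verts_with_proj_eq
    by (metis pawalk_verts_tl with_proj_simps(2))
  let ?l = "length p"
  define s where "s j = snd (p ! (j mod ?l))" for j
  have pos: "0 < ?l" "p \<noteq> []"
    using p(1) by auto
  have next_arc: "fst (p ! (Suc j mod ?l)) = s j" for j
  proof (cases "Suc (j mod ?l) = ?l")
    case True
    then have "Suc j mod ?l = 0" "j mod ?l = ?l - 1"
      by (simp_all add: mod_Suc)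
    then show ?thesis
      using pcas_nth(2)[OF p(2) pos(2)] pos by (simp add: s_def last_conv_nth)
  next
    case False
    then have "Suc (j mod ?l) < ?l"
      using pos by (simp add: Suc_lessI)
    then show ?thesis
      using pcas_nth(1)[OF p(2)] False by (simp add: s_def mod_Suc)
  qed
  have arc: "(s j, s (Suc j)) \<in> parcs H" for j
  proof -
    have "p ! (Suc j mod ?l) \<in> parcs H"
      using p(3) pos(1) by auto
    then show ?thesis
      using next_arc[of j] unfolding s_def by (metis prod.collapse)
  qed
  have s_inj: "a mod ?l = b mod ?l" if "s a = s b" for a b
    using that p(4) pos(1) unfolding s_def
    by (metis distinct_conv_nth length_map mod_less_divisor nth_map)
  have "\<exists>i. i < ?l \<and> (\<forall>j. j < ?l \<longrightarrow> rank (s j) \<le> rank (s i))"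
  proof -
    have fin: "finite ((\<lambda>i. rank (s i)) ` {..<?l})" "(\<lambda>i. rank (s i)) ` {..<?l} \<noteq> {}"
      using pos(1) by auto
    obtain i where "i < ?l" "rank (s i) = Max ((\<lambda>i. rank (s i)) ` {..<?l})"
      using Max_in[OF fin] by auto
    moreover then have "rank (s j) \<le> rank (s i)" if "j < ?l" for j
      using Max_ge[OF fin(1)] that by simp
    ultimately show ?thesis by blast
  qed
  then obtain i where i: "i < ?l" "\<And>j. j < ?l \<Longrightarrow> rank (s j) \<le> rank (s i)"
    by blast
  have s_mod: "s (j mod ?l) = s j" for j
    by (simp add: s_def)
  have max: "rank (s j) \<le> rank (s i)" for j
    using i(2)[of "j mod ?l"] pos(1) s_mod by simp
  define j where "j = i + ?l - 1"
  have si: "s (Suc j) = s i"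
    using pos(1) by (simp add: j_def s_def)
  have "s j = f (s i)"
    using arcs[OF arc[of j]] max[of j] si by auto
  moreover have "s (Suc (Suc j)) = f (s i)"
    using arcs[OF arc[of "Suc j"]] max[of "Suc (Suc j)"] si by auto
  ultimately have "j mod ?l = Suc (Suc j) mod ?l"
    by (intro s_inj) simp
  then have "?l dvd Suc (Suc j) - j"
    by (metis mod_eq_dvd_iff_nat le_add2 add_2_eq_Suc)
  then have "?l dvd 2"
    by simp
  then show False
    using p(1) by (auto dest: dvd_imp_le)
qed

lemma finite_nodes: "finite (nodes n)"
proof -
  have "finite (faces n)" for n
    by (induction n) auto
  then show ?thesis
    by (induction n) auto
qed

lemma edges_irrefl: "irrefl (edges n)"
proof -
  have "a \<noteq> Centre a b c" "b \<noteq> Centre a b c" "c \<noteq> Centre a b c" for a b c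
    by (auto dest: arg_cong[where f = size])
  then show ?thesis
    by (induction n) (fastforce simp: irrefl_def)+
qed

definition apollonian :: "nat \<Rightarrow> nat pair_pre_digraph" where
  "apollonian n = encode (nodes n) (edges n)"

lemma pair_graph_apollonian: "pair_graph (apollonian n)"
  unfolding apollonian_def
proof (rule pair_graph_encode[OF finite_nodes _ _ edges_irrefl])
  show "edges n \<subseteq> nodes n \<times> nodes n"
    using edges_nodes by auto
  show "sym (edges n)"
    by (auto simp: sym_def dest: edges_sym)
qed

lemma planar_apollonian: "apollonian n \<in> planar_graphs"
proof -
  note D = drawn[of n, unfolded drawn_def, THEN conjunct2, THEN conjunct2, THEN conjunct2, THEN conjunct2]
  note inj = D[THEN conjunct1] and avoid = D[THEN conjunct2, THEN conjunct1]
    and cross = D[THEN conjunct2, THEN conjunct2]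
  let ?pos = "\<lambda>i. pos (from_nat i)"
  let ?\<gamma> = "\<lambda>(i, j). linepath (?pos i) (?pos j)"
  have "plane_drawing (apollonian n) ?pos ?\<gamma>"
    unfolding plane_drawing_def
  proof (intro conjI)
    show "inj_on ?pos (pverts (apollonian n))"
      using inj by (auto simp: apollonian_def inj_on_def)
    have arc: "Path_Connected.arc (linepath (pos u) (pos v)) \<and>
        segment u v \<inter> pos ` nodes n = {pos u, pos v}" if "(u, v) \<in> edges n" for u v
    proof
      have uv: "u \<in> nodes n" "v \<in> nodes n" "u \<noteq> v"
        using edges_nodes[OF that] edges_irrefl that by (auto simp: irrefl_def)
      then have "pos u \<noteq> pos v"
        using inj by (auto dest: inj_onD)
      then show "Path_Connected.arc (linepath (pos u) (pos v))"
        by (rule arc_linepath)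
      show "segment u v \<inter> pos ` nodes n = {pos u, pos v}"
        using bspec[OF avoid that] uv(1,2) by auto
    qed
    show "\<forall>(u, v)\<in>parcs (apollonian n).
       Path_Connected.arc (?\<gamma> (u, v)) \<and> pathstart (?\<gamma> (u, v)) = ?pos u \<and>
       pathfinish (?\<gamma> (u, v)) = ?pos v \<and> ?\<gamma> (v, u) = reversepath (?\<gamma> (u, v)) \<and>
       path_image (?\<gamma> (u, v)) \<inter> ?pos ` pverts (apollonian n) = {?pos u, ?pos v}"
    proof
      fix e assume "e \<in> parcs (apollonian n)"
      then obtain u v where e: "(u, v) \<in> edges n" "e = (to_nat u, to_nat v)"
        by (auto simp: apollonian_def)
      show "case e of (u, v) \<Rightarrow>
         Path_Connected.arc (?\<gamma> (u, v)) \<and> pathstart (?\<gamma> (u, v)) = ?pos u \<and>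
         pathfinish (?\<gamma> (u, v)) = ?pos v \<and> ?\<gamma> (v, u) = reversepath (?\<gamma> (u, v)) \<and>
         path_image (?\<gamma> (u, v)) \<inter> ?pos ` pverts (apollonian n) = {?pos u, ?pos v}"
        using arc[OF e(1)] by (simp add: e(2) apollonian_def image_image)
    qed
    have "segment u v \<inter> segment x y \<subseteq> ?pos ` ({to_nat u, to_nat v} \<inter> {to_nat x, to_nat y})"
      if "(u, v) \<in> edges n" "(x, y) \<in> edges n" "{to_nat u, to_nat v} \<noteq> {to_nat x, to_nat y}" for u v x y
    proof -
      have eq: "{to_nat u, to_nat v} \<inter> {to_nat x, to_nat y} = to_nat ` ({u, v} \<inter> {x, y})"
        by auto
      have "{u, v} \<noteq> {x, y}"
        using that(3) by (metis image_insert image_empty)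
      then have "segment u v \<inter> segment x y \<subseteq> pos ` ({u, v} \<inter> {x, y})"
        using bspec[OF bspec[OF cross that(1), unfolded prod.case] that(2)] by simp
      then show ?thesis
        unfolding eq image_image by simp
    qed
    then show "\<forall>(u, v)\<in>parcs (apollonian n). \<forall>(x, y)\<in>parcs (apollonian n). {u, v} \<noteq> {x, y} \<longrightarrow>
       path_image (?\<gamma> (u, v)) \<inter> path_image (?\<gamma> (x, y)) \<subseteq> ?pos ` ({u, v} \<inter> {x, y})"
      unfolding apollonian_def encode_simps by (simp only: ball_simps) (fastforce)
  qed
  then show ?thesis
    using pair_graph_apollonian unfolding planar_graphs_def by blast
qed

text \<open>
  The decomposition tree has a node for each bag: a centre stands for the bag of its face and
  itself, and \<open>Root2\<close> for the outer triangle. The parent of a centre is the last component of its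
  face, which is the newest of the three corners.
\<close>

fun bag :: "vertex \<Rightarrow> vertex set" where
  "bag (Centre p q r) = {p, q, r, Centre p q r}"
| "bag _ = {Root0, Root1, Root2}"

fun parent :: "vertex \<Rightarrow> vertex" where
  "parent (Centre p q r) = r"
| "parent v = v"

definition tree_nodes :: "nat \<Rightarrow> vertex set" where
  "tree_nodes n = nodes n - {Root0, Root1}"

definition tree_arcs :: "nat \<Rightarrow> (vertex \<times> vertex) set" where
  "tree_arcs n = (\<Union>t\<in>tree_nodes n - {Root2}. {(t, parent t), (parent t, t)})"

definition decomposition_tree :: "nat \<Rightarrow> nat pair_pre_digraph" where
  "decomposition_tree n = encode (tree_nodes n) (tree_arcs n)"

lemma faces_third:
  assumes "(p, q, r) \<in> faces n"
  shows "r \<in> tree_nodes n" "{p, q, r} \<subseteq> bag r"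
proof -
  have "r \<notin> {Root0, Root1} \<and> {p, q, r} \<subseteq> bag r"
    using assms by (cases n) auto
  then show "r \<in> tree_nodes n" "{p, q, r} \<subseteq> bag r"
    using faces_nodes[OF assms] by (auto simp: tree_nodes_def)
qed

lemma nodes_mono: "m \<le> n \<Longrightarrow> nodes m \<subseteq> nodes n"
  by (rule lift_Suc_mono_le) auto

lemma Centre_nodesE:
  assumes "Centre p q r \<in> nodes n"
  obtains m where "m < n" "(p, q, r) \<in> faces m"
  using assms by (induction n) (auto intro: less_SucI)

lemma tree_nodeE:
  assumes "t \<in> tree_nodes n" "t \<noteq> Root2"
  obtains p q r m where "t = Centre p q r" "m < n" "(p, q, r) \<in> faces m"
proof -
  have t: "t \<in> nodes n" "t \<noteq> Root0" "t \<noteq> Root1"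
    using assms(1) by (auto simp: tree_nodes_def)
  then obtain p q r where pqr: "t = Centre p q r"
    using assms(2) by (cases t) auto
  with t(1) obtain m where "m < n" "(p, q, r) \<in> faces m"
    by (auto elim: Centre_nodesE)
  with pqr show thesis
    by (rule that)
qed

lemma parent_props:
  assumes "t \<in> tree_nodes n" "t \<noteq> Root2"
  shows "parent t \<in> tree_nodes n" "size (parent t) < size t" "bag t - {t} \<subseteq> bag (parent t)"
    "bag t \<subseteq> nodes n"
proof -
  obtain p q r m where t: "t = Centre p q r" "m < n" "(p, q, r) \<in> faces m"
    using tree_nodeE[OF assms] .
  have m: "nodes m \<subseteq> nodes n"
    using nodes_mono t(2) by simp
  show "parent t \<in> tree_nodes n" "bag t - {t} \<subseteq> bag (parent t)"
    using faces_third[OF t(3)] m t(1) by (auto simp: tree_nodes_def)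
  show "size (parent t) < size t"
    using t(1) by simp
  show "bag t \<subseteq> nodes n"
    using faces_nodes[OF t(3)] m t(1) assms(1) by (auto simp: tree_nodes_def)
qed

lemma Root_nodes: "{Root0, Root1, Root2} \<subseteq> nodes n"
  by (induction n) auto

lemma Root2_tree_nodes: "Root2 \<in> tree_nodes n"
  using Root_nodes[of n] by (auto simp: tree_nodes_def)

lemma undirected_tree_decomposition_tree: "undirected_tree (decomposition_tree n)"
  unfolding undirected_tree_def
proof (intro conjI)
  let ?T = "decomposition_tree n"
  show "pair_graph ?T"
    unfolding decomposition_tree_def
  proof (rule pair_graph_encode)
    show "finite (tree_nodes n)"
      using finite_nodes by (simp add: tree_nodes_def)
    show "tree_arcs n \<subseteq> tree_nodes n \<times> tree_nodes n" "irrefl (tree_arcs n)" "sym (tree_arcs n)"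
      using parent_props(1,2) by (fastforce simp: tree_arcs_def irrefl_def sym_def)+
  qed
  show "Digraph_Component.connected (with_proj ?T)"
  proof (rule connected_if_rooted[where base = "to_nat Root2" and rank = "\<lambda>i. size (from_nat i :: vertex)"
        and f = "\<lambda>i. to_nat (parent (from_nat i))"])
    fix i assume "i \<in> verts (with_proj ?T)" "i \<noteq> to_nat Root2"
    then obtain t where t: "i = to_nat t" "t \<in> tree_nodes n" "t \<noteq> Root2"
      by (auto simp: decomposition_tree_def)
    then show "to_nat (parent (from_nat i)) \<in> verts (with_proj ?T) \<and>
      size (from_nat (to_nat (parent (from_nat i))) :: vertex) < size (from_nat i :: vertex) \<and>
      (i, to_nat (parent (from_nat i))) \<in> arcs_ends (with_proj ?T)"
      using parent_props(1,2)[OF t(2,3)] by (auto simp: decomposition_tree_def tree_arcs_def)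
  qed (use Root2_tree_nodes in \<open>simp add: decomposition_tree_def\<close>)
  show "\<not> (\<exists>p. pre_digraph.cycle (with_proj ?T) p \<and> 3 \<le> length p)"
  proof (rule no_cycle_if_ranked[where rank = "\<lambda>i. size (from_nat i :: vertex)"
        and f = "\<lambda>i. to_nat (parent (from_nat i))"])
    fix x y assume "(x, y) \<in> parcs ?T"
    then show "y = to_nat (parent (from_nat x)) \<and> size (from_nat y :: vertex) < size (from_nat x :: vertex) \<or>
      x = to_nat (parent (from_nat y)) \<and> size (from_nat x :: vertex) < size (from_nat y :: vertex)"
      using parent_props(2) by (auto simp: decomposition_tree_def tree_arcs_def)
  qed
qed

lemma connected_bags_containing:
  assumes "v \<in> nodes n"
  shows "Digraph_Component.connected (with_proj (decomposition_tree n) \<restriction>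
    (to_nat ` {t \<in> tree_nodes n. v \<in> bag t}))"
proof -
  let ?S = "{t \<in> tree_nodes n. v \<in> bag t}"
  define apex where "apex = (if v \<in> tree_nodes n then v else Root2)"
  have apex: "apex \<in> ?S"
  proof (cases "v \<in> tree_nodes n")
    case True
    moreover have "v \<in> bag v"
      using True by (cases v) (auto simp: tree_nodes_def)
    ultimately show ?thesis by (simp add: apex_def)
  next
    case False
    then have "v \<in> {Root0, Root1}"
      using assms by (simp add: tree_nodes_def)
    then show ?thesis
      using False Root2_tree_nodes by (auto simp: apex_def)
  qed
  have up: "t \<noteq> Root2 \<and> parent t \<in> ?S" if "t \<in> ?S" "t \<noteq> apex" for t
  proof
    show "t \<noteq> Root2"
      using that Root2_tree_nodes by (auto simp: apex_def tree_nodes_def split: if_splits)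
    moreover have "v \<noteq> t"
      using that by (auto simp: apex_def)
    ultimately show "parent t \<in> ?S"
      using that(1) parent_props(1,3)[of t n] by blast
  qed
  let ?H = "with_proj (decomposition_tree n) \<restriction> (to_nat ` ?S)"
  show ?thesis
  proof (rule connected_if_rooted[where base = "to_nat apex" and rank = "\<lambda>i. size (from_nat i :: vertex)"
        and f = "\<lambda>i. to_nat (parent (from_nat i))"])
    fix i assume "i \<in> verts ?H" "i \<noteq> to_nat apex"
    then obtain t where t: "i = to_nat t" "t \<in> ?S" "t \<noteq> apex"
      by auto
    have "(t, parent t) \<in> tree_arcs n"
      using t(2) up[OF t(2,3)] by (auto simp: tree_arcs_def)
    then have "(i, to_nat (parent t)) \<in> arcs_ends ?H"
      using t(1,2) up[OF t(2,3)] by (auto simp: arcs_ends_conv decomposition_tree_def)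
    then show "to_nat (parent (from_nat i)) \<in> verts ?H \<and>
      size (from_nat (to_nat (parent (from_nat i))) :: vertex) < size (from_nat i :: vertex) \<and>
      (i, to_nat (parent (from_nat i))) \<in> arcs_ends ?H"
      using t(1,2) up[OF t(2,3)] parent_props(2)[of t n] by auto
  qed (use apex in simp)
qed

lemma edge_in_bag: "(u, v) \<in> edges n \<Longrightarrow> \<exists>t\<in>tree_nodes n. u \<in> bag t \<and> v \<in> bag t"
proof (induction n)
  case 0
  then show ?case
    by (intro bexI[of _ Root2]) (auto simp: tree_nodes_def)
next
  case (Suc n)
  from Suc.prems show ?case
  proof (cases rule: edges_SucE)
    case 1
    moreover have "tree_nodes n \<subseteq> tree_nodes (Suc n)"
      by (auto simp: tree_nodes_def)
    ultimately show ?thesis using Suc.IH by blast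
  next
    case (2 p q r a)
    have "Centre p q r \<in> tree_nodes (Suc n)"
      using 2(1) by (force simp: tree_nodes_def)
    moreover have "{u, v} \<subseteq> bag (Centre p q r)"
      unfolding 2(3) using 2(2) by auto
    ultimately show ?thesis by blast
  qed
qed

lemma tree_decomposition_apollonian:
  "tree_decomposition (apollonian n) (decomposition_tree n) (\<lambda>i. to_nat ` bag (from_nat i))"
  unfolding tree_decomposition_def
proof (intro conjI)
  show "undirected_tree (decomposition_tree n)"
    by (rule undirected_tree_decomposition_tree)
  have "(\<Union>t\<in>tree_nodes n. bag t) = nodes n"
  proof
    show "(\<Union>t\<in>tree_nodes n. bag t) \<subseteq> nodes n"
    proof (rule UN_least)
      fix t assume "t \<in> tree_nodes n"
      then show "bag t \<subseteq> nodes n"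
        using parent_props(4) Root_nodes by (cases "t = Root2") auto
    qed
    show "nodes n \<subseteq> (\<Union>t\<in>tree_nodes n. bag t)"
    proof
      fix v assume v: "v \<in> nodes n"
      show "v \<in> (\<Union>t\<in>tree_nodes n. bag t)"
      proof (cases "v \<in> tree_nodes n")
        case True
        moreover have "v \<in> bag v"
          by (cases v) auto
        ultimately show ?thesis by blast
      next
        case False
        then have "v \<in> bag Root2"
          using v by (auto simp: tree_nodes_def)
        then show ?thesis using Root2_tree_nodes by blast
      qed
    qed
  qed
  then show "(\<Union>t\<in>pverts (decomposition_tree n). to_nat ` bag (from_nat t)) = pverts (apollonian n)"
    by (simp add: decomposition_tree_def apollonian_def flip: image_UN)
  show "\<forall>(u, v)\<in>parcs (apollonian n). \<exists>t\<in>pverts (decomposition_tree n).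
      u \<in> to_nat ` bag (from_nat t) \<and> v \<in> to_nat ` bag (from_nat t)"
    using edge_in_bag by (fastforce simp: decomposition_tree_def apollonian_def)
  show "\<forall>v\<in>pverts (apollonian n). Digraph_Component.connected (with_proj (decomposition_tree n) \<restriction>
      {t \<in> pverts (decomposition_tree n). v \<in> to_nat ` bag (from_nat t)})"
  proof
    fix i assume "i \<in> pverts (apollonian n)"
    then obtain v where v: "i = to_nat v" "v \<in> nodes n"
      by (auto simp: apollonian_def)
    have "{t \<in> pverts (decomposition_tree n). i \<in> to_nat ` bag (from_nat t)} =
        to_nat ` {t \<in> tree_nodes n. v \<in> bag t}"
      using v(1) by (auto simp: decomposition_tree_def)
    then show "Digraph_Component.connected (with_proj (decomposition_tree n) \<restriction>
        {t \<in> pverts (decomposition_tree n). i \<in> to_nat ` bag (from_nat t)})"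
      using connected_bags_containing[OF v(2)] by simp
  qed
qed

lemma card_bag: "card (bag t) \<le> 4"
  by (cases t) (auto simp: card_insert_if)

lemma apollonian_tw: "apollonian n \<in> tw_graphs 3"
proof -
  let ?T = "decomposition_tree n" and ?B = "\<lambda>i. to_nat ` bag (from_nat i)"
  have "treewidth (apollonian n) \<le> decomposition_width ?T ?B"
    unfolding treewidth_def by (rule Least_le) (use tree_decomposition_apollonian in blast)
  moreover have "Max ((\<lambda>t. card (?B t)) ` pverts ?T) \<le> 4"
  proof (rule Max.boundedI)
    show "finite ((\<lambda>t. card (?B t)) ` pverts ?T)" "(\<lambda>t. card (?B t)) ` pverts ?T \<noteq> {}"
      using finite_nodes Root2_tree_nodes by (auto simp: decomposition_tree_def tree_nodes_def)
    show "m \<le> 4" if "m \<in> (\<lambda>t. card (?B t)) ` pverts ?T" for m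
      using that card_bag by (auto simp: card_image)
  qed
  ultimately show ?thesis
    using pair_graph_apollonian by (simp add: tw_graphs_def decomposition_width_def)
qed


section \<open>Fans and long squares\<close>

fun fan :: "vertex \<Rightarrow> vertex \<Rightarrow> vertex \<Rightarrow> nat \<Rightarrow> vertex" where
  "fan p q r 0 = Centre p q r"
| "fan p q r (Suc j) = Centre p q (fan p q r j)"

lemma face_children:
  assumes "face p q r"
  shows "face p q (Centre p q r)" "face q r (Centre p q r)" "face p r (Centre p q r)"
proof -
  obtain n where "(p, q, r) \<in> faces n"
    using assms by (auto simp: face_def)
  then have "{(p, q, Centre p q r), (q, r, Centre p q r), (p, r, Centre p q r)} \<subseteq> faces (Suc n)"
    by fastforce
  then show "face p q (Centre p q r)" "face q r (Centre p q r)" "face p r (Centre p q r)"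
    unfolding face_def by blast+
qed

lemma faces_distinct: "(p, q, r) \<in> faces n \<Longrightarrow> distinct [p, q, r]"
proof (induction n arbitrary: p q r)
  case 0
  then show ?case by auto
next
  case (Suc n)
  have neq: "a \<noteq> Centre a b c" "b \<noteq> Centre a b c" "c \<noteq> Centre a b c" for a b c
    by (auto dest: arg_cong[where f = size])
  obtain a b c where abc: "(a, b, c) \<in> faces n"
    "(p, q, r) \<in> {(a, b, Centre a b c), (b, c, Centre a b c), (a, c, Centre a b c)}"
    using Suc.prems by auto
  have "distinct [a, b, c]"
    by (rule Suc.IH[OF abc(1)])
  then show ?case
    using abc(2) neq[of a b c] by auto
qed

lemma face_distinct: "face p q r \<Longrightarrow> distinct [p, q, r]"
  using faces_distinct by (auto simp: face_def)

lemma faces_edges: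
  "(p, q, r) \<in> faces n \<Longrightarrow> {(p, q), (q, r), (p, r)} \<subseteq> edges n"
proof (induction n arbitrary: p q r)
  case 0
  then show ?case by auto
next
  case (Suc n)
  obtain a b c where abc: "(a, b, c) \<in> faces n"
    "(p, q, r) \<in> {(a, b, Centre a b c), (b, c, Centre a b c), (a, c, Centre a b c)}"
    using Suc.prems by auto
  have old: "{(a, b), (b, c), (a, c)} \<subseteq> edges n"
    by (rule Suc.IH[OF abc(1)])
  have new: "x \<in> {a, b, c} \<Longrightarrow> (x, Centre a b c) \<in> edges (Suc n)" for x
    using abc(1) by fastforce
  show ?case
    using abc(2) old new by auto
qed

lemma edges_mono: "m \<le> n \<Longrightarrow> edges m \<subseteq> edges n"
  by (rule lift_Suc_mono_le) auto

lemma adj_sym: "adj a b \<longleftrightarrow> adj b a"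
  by (auto simp: adj_def dest: edges_sym)

lemma face_adj: "face p q r \<Longrightarrow> adj p q \<and> adj q r \<and> adj p r"
  unfolding face_def adj_def using faces_edges by blast

lemma fan_face: "face p q r \<Longrightarrow> face p q (fan p q r j)"
  by (induction j) (auto intro: face_children)

lemma fan_faces:
  assumes "face p q r"
  shows "face p (fan p q r j) (fan p q r (Suc j))" "face q (fan p q r j) (fan p q r (Suc j))"
  using face_children[OF fan_face[OF assms, of j]] by auto

lemma fan_Centre: "\<exists>c. fan p q r j = Centre p q c"
  by (cases j) auto

lemma fan_neq_fan: "(p, q) \<noteq> (p', q') \<Longrightarrow> fan p q r j \<noteq> fan p' q' r' j'"
  by (cases j; cases j') auto

lemma size_fan: "size p < size (fan p q r j)" "size q < size (fan p q r j)"
  by (cases j; simp)+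

lemma fan_neq [simp]: "fan p q r j \<noteq> p" "fan p q r j \<noteq> q"
  using size_fan[of p q r j] size_fan[of q p r j] by auto

lemma inj_fan: "inj (fan p q r)"
proof -
  have "strict_mono (\<lambda>j. size (fan p q r j))"
    by (rule strict_mono_Suc_iff[THEN iffD2]) simp
  then have "inj (\<lambda>j. size (fan p q r j))"
    by (rule strict_mono_imp_inj_on)
  then show ?thesis
    by (auto simp: inj_def)
qed

lemma fan_adj:
  assumes "face p q r"
  shows "adj p (fan p q r j)" "adj q (fan p q r j)" "adj (fan p q r j) (fan p q r (Suc j))"
  using face_adj[OF fan_faces(1)[OF assms, of j]] face_adj[OF fan_faces(2)[OF assms, of j]] by auto

declare fan.simps [simp del]

lemma windows_recur:
  fixes f :: "nat \<Rightarrow> 'a"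
  assumes "finite (range f)"
  shows "\<exists>N. \<forall>i\<ge>N. \<exists>i'. i' + L \<le> i \<and> (\<forall>l<L. f (i' + l) = f (i + l))"
proof -
  define g where "g i = map (\<lambda>l. f (i + l)) [0..<L]" for i
  have "range g \<subseteq> {xs. set xs \<subseteq> range f \<and> length xs = L}"
    by (auto simp: g_def)
  then have "finite (range g)"
    using finite_lists_length_eq[OF assms] finite_subset by blast
  then obtain C where C: "finite C" "range g = g ` C"
    by (metis finite_subset_image subset_refl)
  obtain m where m: "\<forall>i\<in>C. i \<le> m"
    using C(1) finite_nat_set_iff_bounded_le by blast
  have "\<exists>i'. i' + L \<le> i \<and> (\<forall>l<L. f (i' + l) = f (i + l))" if "i \<ge> m + L" for i
  proof -
    obtain i' where i': "i' \<in> C" "g i = g i'"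
      using C(2) by blast
    have "f (i' + l) = f (i + l)" if "l < L" for l
      using arg_cong[OF i'(2), of "\<lambda>xs. xs ! l"] that by (simp add: g_def)
    moreover have "i' + L \<le> i"
      using m i'(1) \<open>i \<ge> m + L\<close> by fastforce
    ultimately show ?thesis by blast
  qed
  then show ?thesis by blast
qed

locale long_square_free =
  fixes k :: nat and col :: "vertex \<Rightarrow> nat"
  assumes k_pos: "k \<ge> 1"
    and col_less: "col v < 10"
    and no_square: "\<lbrakk>k \<le> length vs; distinct (vs @ ws); successively adj (vs @ ws)\<rbrakk>
      \<Longrightarrow> map col vs \<noteq> map col ws"
begin

lemma finite_range_col: "finite (range (\<lambda>j. col (f j)))"
  by (rule finite_subset[of _ "{..<10}"]) (use col_less in auto)

definition next_to :: "nat \<Rightarrow> nat \<Rightarrow> bool" where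
  "next_to i j \<longleftrightarrow> i = Suc j \<or> j = Suc i"

lemma successively_next_to_upt: "successively next_to [i..<j]"
  by (induction "j - i" arbitrary: i j)
     (auto simp: successively_conv_nth next_to_def)

lemma successively_next_to_rev_upt: "successively next_to (rev [i..<j])"
  by (rule successively_mono[OF successively_rev[THEN iffD2, OF successively_next_to_upt]])
     (auto simp: next_to_def)

lemma successively_fan:
  assumes "face p q r" "successively next_to js"
  shows "successively adj (map (fan p q r) js)"
  unfolding successively_map
  by (rule successively_mono[OF assms(2)])
     (use fan_adj(3)[OF assms(1)] adj_sym in \<open>auto simp: next_to_def\<close>)

text \<open>The path runs along the fan indices \<open>is\<close>, through the hub \<open>e\<close>, along \<open>js\<close>, and leaves the fan by \<open>ys\<close>.\<close>

lemma fan_no_square: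
  assumes "face p q r" "e \<in> {p, q}"
    and idx: "distinct (is @ js)" "successively next_to is" "successively next_to js"
      "js \<noteq> []" "k \<le> length is"
    and ys: "distinct ys" "set ys \<inter> range (fan p q r) = {}" "e \<notin> set ys"
      "successively adj (fan p q r (last js) # ys)"
    and eq: "map (col \<circ> fan p q r) is @ [col e] = map (col \<circ> fan p q r) js @ map col ys"
  shows False
proof -
  let ?f = "fan p q r"
  have [simp]: "is \<noteq> []"
    using k_pos idx(5) by auto
  have e: "adj e (?f j)" "adj (?f j) e" "e \<noteq> ?f j" for j
    using fan_adj[OF assms(1), of j] adj_sym fan_neq[of p q r j] assms(2) by auto
  have "distinct ((map ?f is @ [e]) @ (map ?f js @ ys))"
    using idx(1) ys(1-3) e(3) by (auto simp: distinct_map inj_fan[THEN inj_on_subset] inj_eq[OF inj_fan])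
  moreover have "successively adj (map ?f js @ ys)"
    using successively_fan[OF assms(1) idx(3)] ys(4) idx(4)
    by (cases ys) (auto simp: successively_append_iff last_map)
  then have "successively adj ((map ?f is @ [e]) @ (map ?f js @ ys))"
    using successively_fan[OF assms(1) idx(2)] idx(4) e
    by (auto simp: successively_append_iff successively_Cons last_map hd_map)
  ultimately have "map col (map ?f is @ [e]) \<noteq> map col (map ?f js @ ys)"
    by (intro no_square) (use idx(5) in auto)
  then show False
    using eq by simp
qed

lemma col_face_fst_snd:
  assumes "face p q r"
  shows "col p \<noteq> col q"
proof
  assume "col p = col q"
  obtain i i' where i: "i' + k \<le> i"
    "\<forall>l<k. col (fan p q r (i' + l)) = col (fan p q r (i + l))"
    using windows_recur[OF finite_range_col] by blast
  have pq: "p \<noteq> q" "adj q (fan p q r j)" for j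
    using face_distinct[OF assms] fan_adj[OF assms] by auto
  show False
  proof (rule fan_no_square[OF assms, of p "[i'..<i' + k]" "[i..<i + k]" "[q]"])
    show "map (col \<circ> fan p q r) [i'..<i' + k] @ [col p] =
        map (col \<circ> fan p q r) [i..<i + k] @ map col [q]"
      using \<open>col p = col q\<close> i(2) by (auto intro!: nth_equalityI)
    show "set [q] \<inter> range (fan p q r) = {}"
      using fan_neq(2)[of p q r] by (auto dest: sym)
  qed (use i(1) k_pos pq adj_sym in \<open>auto simp: successively_next_to_upt\<close>)
qed

lemma col_face:
  assumes "face p q r"
  shows "col p \<noteq> col q" "col q \<noteq> col r" "col p \<noteq> col r"
  using col_face_fst_snd face_children[OF assms] assms by blast+

lemma col_fan:
  assumes "face p q r"
  shows "col (fan p q r j) \<noteq> col p" "col (fan p q r j) \<noteq> col q"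
    "col (fan p q r j) \<noteq> col (fan p q r (Suc j))"
  using col_face[OF fan_face[OF assms, of j]] col_face(2)[OF fan_faces(1)[OF assms, of j]]
  by auto

text \<open>Otherwise two colors would alternate from some point on.\<close>

lemma frequently_three_colours:
  assumes "face p q r"
  shows "\<exists>\<^sub>F j in sequentially.
    distinct [col (fan p q r j), col (fan p q r (Suc j)), col (fan p q r (Suc (Suc j)))]"
proof (rule ccontr)
  let ?c = "\<lambda>j. col (fan p q r j)"
  assume "\<not> ?thesis"
  then obtain N where N: "\<forall>j\<ge>N. \<not> distinct [?c j, ?c (Suc j), ?c (Suc (Suc j))]"
    by (auto simp: not_frequently eventually_sequentially simp del: distinct.simps)
  have N: "?c (Suc (Suc j)) = ?c j" if "j \<ge> N" for j
    using N that col_fan(3)[OF assms, of j] col_fan(3)[OF assms, of "Suc j"] by auto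
  have per: "?c (N + l + 2 * m) = ?c (N + l)" for l m
    by (induction m) (use N in auto)
  let ?vs = "map (fan p q r) [N..<N + 2 * k]" and ?ws = "map (fan p q r) [N + 2 * k..<N + 4 * k]"
  have "map (fan p q r) [N..<N + 4 * k] = ?vs @ ?ws"
    using upt_add_eq_append[of N "N + 2 * k" "2 * k"] by (simp flip: map_append add: algebra_simps)
  moreover have "distinct (map (fan p q r) [N..<N + 4 * k])"
    by (simp add: distinct_map inj_fan[THEN inj_on_subset])
  moreover have "successively adj (map (fan p q r) [N..<N + 4 * k])"
    by (rule successively_fan[OF assms successively_next_to_upt])
  ultimately have "distinct (?vs @ ?ws)" "successively adj (?vs @ ?ws)"
    by simp_all
  moreover have "map col ?vs = map col ?ws"
    using per[where m = k] by (auto intro!: nth_equalityI simp: algebra_simps)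
  ultimately show False
    using no_square[of ?vs ?ws] by auto
qed

lemma eventually_dist2:
  assumes "face p q r"
  shows "\<forall>\<^sub>F j in sequentially. \<forall>w. adj (fan p q r j) w \<longrightarrow> w \<notin> range (fan p q r) \<longrightarrow>
    w \<notin> {p, q} \<longrightarrow> col w \<noteq> col p \<and> col w \<noteq> col q"
proof -
  obtain N where N: "\<forall>i\<ge>N. \<exists>i'. i' + (k + 1) \<le> i \<and>
      (\<forall>l<k + 1. col (fan p q r (i' + l)) = col (fan p q r (i + l)))"
    using windows_recur[OF finite_range_col[of "fan p q r"], of "k + 1"] by blast
  have "False"
    if j: "j \<ge> N + k" and w: "adj (fan p q r j) w" "w \<notin> range (fan p q r)" "w \<notin> {p, q}"
      and e: "e \<in> {p, q}" "col w = col e" for j w e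
  proof -
    obtain i' where i': "i' + (k + 1) \<le> j - k"
      "\<forall>l<k + 1. col (fan p q r (i' + l)) = col (fan p q r (j - k + l))"
      using N[rule_format, of "j - k"] j by (metis add_le_imp_le_diff)
    show False
    proof (rule fan_no_square[OF assms e(1), of "[i'..<i' + (k + 1)]" "[j - k..<j - k + (k + 1)]" "[w]"])
      show "map (col \<circ> fan p q r) [i'..<i' + (k + 1)] @ [col e] =
          map (col \<circ> fan p q r) [j - k..<j - k + (k + 1)] @ map col [w]"
        using e(2) i'(2) by (auto intro!: nth_equalityI simp del: upt_Suc)
    qed (use i'(1) j w e in \<open>auto simp: successively_next_to_upt simp del: upt_Suc\<close>)
  qed
  then have "\<forall>j\<ge>N + k. \<forall>w. adj (fan p q r j) w \<longrightarrow> w \<notin> range (fan p q r) \<longrightarrow>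
    w \<notin> {p, q} \<longrightarrow> col w \<noteq> col p \<and> col w \<noteq> col q"
    by blast
  then show ?thesis
    unfolding eventually_sequentially by blast
qed

lemma eventually_dist3:
  assumes "face p q r"
  shows "\<forall>\<^sub>F j in sequentially. \<forall>t w. adj (fan p q r (Suc j)) t \<longrightarrow> adj t w \<longrightarrow> t \<noteq> w \<longrightarrow>
    {t, w} \<inter> range (fan p q r) = {} \<longrightarrow> {t, w} \<inter> {p, q} = {} \<longrightarrow>
    col t \<in> {col (fan p q r j), col (fan p q r (Suc (Suc j)))} \<longrightarrow>
    col w \<noteq> col p \<and> col w \<noteq> col q"
proof -
  obtain N where N: "\<forall>i\<ge>N. \<exists>i'. i' + (k + 2) \<le> i \<and>
      (\<forall>l<k + 2. col (fan p q r (i' + l)) = col (fan p q r (i + l)))"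
    using windows_recur[OF finite_range_col[of "fan p q r"], of "k + 2"] by blast
  have "False"
    if j: "j \<ge> N + k" and t: "adj (fan p q r (Suc j)) t" "adj t w" "t \<noteq> w"
      "{t, w} \<inter> range (fan p q r) = {}" "{t, w} \<inter> {p, q} = {}"
      "col t \<in> {col (fan p q r j), col (fan p q r (Suc (Suc j)))}"
      and e: "e \<in> {p, q}" "col w = col e" for j t w e
    using t(6)
  proof
    assume tj: "col t = col (fan p q r j)"
    obtain i' where i': "i' + (k + 2) \<le> j"
      "\<forall>l<k + 2. col (fan p q r (i' + l)) = col (fan p q r (j + l))"
      using N[rule_format, of "j"] j by auto
    have fst: "col (fan p q r i') = col (fan p q r j)"
      using i'(2) by (metis add.right_neutral add_gr_0 zero_less_numeral)
    show False
    proof (rule fan_no_square[OF assms e(1), of "rev [i'..<i' + (k + 2)]" "rev [Suc j..<j + (k + 2)]" "[t, w]"])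
      have "map (col \<circ> fan p q r) [Suc i'..<i' + (k + 2)] = map (col \<circ> fan p q r) [Suc j..<j + (k + 2)]"
        using i'(2) by (auto intro!: nth_equalityI simp del: upt_Suc simp flip: add_Suc_right)
      moreover have "[i'..<i' + (k + 2)] = i' # [Suc i'..<i' + (k + 2)]"
        by (rule upt_conv_Cons) simp
      ultimately show "map (col \<circ> fan p q r) (rev [i'..<i' + (k + 2)]) @ [col e] =
          map (col \<circ> fan p q r) (rev [Suc j..<j + (k + 2)]) @ map col [t, w]"
        using e(2) tj fst by (simp flip: rev_map del: upt_Suc)
    qed (use i'(1) j t e in \<open>auto simp: successively_next_to_rev_upt last_rev
        simp del: upt_Suc successively_rev\<close>)
  next
    assume "col t \<in> {col (fan p q r (Suc (Suc j)))}"
    then have tj: "col t = col (fan p q r (Suc (Suc j)))" by simp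
    define i where "i = Suc j - k"
    have ij: "Suc j = i + k" "i \<ge> N"
      using j by (auto simp: i_def)
    obtain i' where i': "i' + (k + 2) \<le> i"
      "\<forall>l<k + 2. col (fan p q r (i' + l)) = col (fan p q r (i + l))"
      using N[rule_format, OF ij(2)] by auto
    have lst: "col (fan p q r (i' + (k + 1))) = col (fan p q r (i + (k + 1)))"
      using i'(2)[rule_format, of "k + 1"] by simp
    show False
    proof (rule fan_no_square[OF assms e(1), of "[i'..<i' + (k + 2)]" "[i..<i + (k + 1)]" "[t, w]"])
      have "map (col \<circ> fan p q r) [i'..<i' + (k + 1)] = map (col \<circ> fan p q r) [i..<i + (k + 1)]"
        using i'(2) by (auto intro!: nth_equalityI simp del: upt_Suc)
      moreover have "[i'..<i' + (k + 2)] = [i'..<i' + (k + 1)] @ [i' + (k + 1)]"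
        by simp
      ultimately show "map (col \<circ> fan p q r) [i'..<i' + (k + 2)] @ [col e] =
          map (col \<circ> fan p q r) [i..<i + (k + 1)] @ map col [t, w]"
        using e(2) tj lst ij(1) by (simp del: upt_Suc)
    qed (use i'(1) ij t e in \<open>auto simp: successively_next_to_upt simp del: upt_Suc\<close>)
  qed
  then have "\<forall>j\<ge>N + k. \<forall>t w. adj (fan p q r (Suc j)) t \<longrightarrow> adj t w \<longrightarrow> t \<noteq> w \<longrightarrow>
    {t, w} \<inter> range (fan p q r) = {} \<longrightarrow> {t, w} \<inter> {p, q} = {} \<longrightarrow>
    col t \<in> {col (fan p q r j), col (fan p q r (Suc (Suc j)))} \<longrightarrow>
    col w \<noteq> col p \<and> col w \<noteq> col q"
    by blast
  then show ?thesis
    unfolding eventually_sequentially by blast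
qed

lemma obtain_turn:
  assumes "face p q r" "\<forall>\<^sub>F j in sequentially. P j"
  obtains j where "distinct (map (\<lambda>i. col (fan p q r i)) [j, Suc j, Suc (Suc j)])"
    and "P j" "P (Suc j)" "P (Suc (Suc j))"
    and "\<And>i w. \<lbrakk>i \<in> {j, Suc j, Suc (Suc j)}; adj (fan p q r i) w; w \<notin> range (fan p q r);
      w \<notin> {p, q}\<rbrakk> \<Longrightarrow> col w \<noteq> col p \<and> col w \<noteq> col q"
    and "\<And>t w. \<lbrakk>adj (fan p q r (Suc j)) t; adj t w; t \<noteq> w; {t, w} \<inter> range (fan p q r) = {};
      {t, w} \<inter> {p, q} = {}; col t \<in> {col (fan p q r j), col (fan p q r (Suc (Suc j)))}\<rbrakk>
      \<Longrightarrow> col w \<noteq> col p \<and> col w \<noteq> col q"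
proof -
  define Q where "Q j \<longleftrightarrow> P j \<and> (\<forall>w. adj (fan p q r j) w \<longrightarrow> w \<notin> range (fan p q r) \<longrightarrow>
    w \<notin> {p, q} \<longrightarrow> col w \<noteq> col p \<and> col w \<noteq> col q)" for j
  define R where "R j \<longleftrightarrow> (\<forall>t w. adj (fan p q r (Suc j)) t \<longrightarrow> adj t w \<longrightarrow> t \<noteq> w \<longrightarrow>
    {t, w} \<inter> range (fan p q r) = {} \<longrightarrow> {t, w} \<inter> {p, q} = {} \<longrightarrow>
    col t \<in> {col (fan p q r j), col (fan p q r (Suc (Suc j)))} \<longrightarrow>
    col w \<noteq> col p \<and> col w \<noteq> col q)" for j
  define T where "T j \<longleftrightarrow> distinct [col (fan p q r j), col (fan p q r (Suc j)),
    col (fan p q r (Suc (Suc j)))]" for j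
  have Q: "\<forall>\<^sub>F j in sequentially. Q j"
    unfolding Q_def using assms(2) eventually_dist2[OF assms(1)] by (rule eventually_conj)
  then have Q': "\<forall>\<^sub>F j in sequentially. Q (Suc j)"
    by (rule eventually_sequentially_Suc[THEN iffD2])
  then have "\<forall>\<^sub>F j in sequentially. Q (Suc (Suc j))"
    by (rule eventually_sequentially_Suc[THEN iffD2])
  moreover have "\<forall>\<^sub>F j in sequentially. R j"
    unfolding R_def by (rule eventually_dist3[OF assms(1)])
  ultimately have "\<forall>\<^sub>F j in sequentially. Q j \<and> Q (Suc j) \<and> Q (Suc (Suc j)) \<and> R j"
    using Q Q' by (simp add: eventually_conj_iff)
  moreover have "\<exists>\<^sub>F j in sequentially. T j"
    unfolding T_def by (rule frequently_three_colours[OF assms(1)])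
  ultimately have "\<exists>\<^sub>F j in sequentially. (Q j \<and> Q (Suc j) \<and> Q (Suc (Suc j)) \<and> R j) \<and> T j"
    by (intro frequently_eventually_conj)
  then obtain j where j: "Q j" "Q (Suc j)" "Q (Suc (Suc j))" "R j" "T j"
    by (auto dest: frequently_ex)
  show thesis
  proof (rule that)
    show "distinct (map (\<lambda>i. col (fan p q r i)) [j, Suc j, Suc (Suc j)])"
      using j(5) by (simp add: T_def)
    show "P j" "P (Suc j)" "P (Suc (Suc j))"
      using j(1-3) by (simp_all add: Q_def)
    show "col w \<noteq> col p \<and> col w \<noteq> col q"
      if "i \<in> {j, Suc j, Suc (Suc j)}" "adj (fan p q r i) w" "w \<notin> range (fan p q r)" "w \<notin> {p, q}" for i w
    proof -
      have "Q i"
        using that(1) j(1-3) by auto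
      then show ?thesis
        unfolding Q_def using that(2-4) by simp
    qed
    show "col w \<noteq> col p \<and> col w \<noteq> col q"
      if "adj (fan p q r (Suc j)) t" "adj t w" "t \<noteq> w" "{t, w} \<inter> range (fan p q r) = {}"
        "{t, w} \<inter> {p, q} = {}" "col t \<in> {col (fan p q r j), col (fan p q r (Suc (Suc j)))}" for t w
      using j(4)[unfolded R_def, rule_format, OF that] .
  qed
qed

lemma fan_notin_range: "(p, q) \<noteq> (p', q') \<Longrightarrow> fan p q r j \<notin> range (fan p' q' r')"
  using fan_neq_fan by blast

text \<open>
  Follow fans \<open>ts\<close>, \<open>tq\<close>, \<open>tw\<close>, each starting at a vertex of the previous one. The fan \<open>tq\<close> uses all
  3 colors left after \<open>s\<close> and \<open>q\<close>, so \<open>w\<close> can be chosen with the color of a neighbor of \<open>q\<close> on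
  \<open>ts\<close>. Then \<open>tw\<close> also avoids the color of \<open>s\<close>, and only 2 colors remain for it.
\<close>

lemma palette_at_least_6:
  assumes K: "finite K" "card K \<le> 5" "K \<subseteq> M"
    and start: "face t s0 r0" "col s0 \<in> M"
    and palette: "\<And>a b. \<lbrakk>face t a b; col a \<in> M\<rbrakk> \<Longrightarrow> \<forall>\<^sub>F j in sequentially. col (fan t a b j) \<in> K"
  shows False
proof -
  obtain j0 where j0: "col (fan t s0 r0 j0) \<in> K"
    using palette[OF start] by (auto simp: eventually_sequentially)
  define s b1 where "s = fan t s0 r0 j0" and "b1 = fan t s0 r0 (Suc j0)"
  have s: "col s \<in> K" "face t s b1"
    using j0 fan_faces(1)[OF start(1), of j0] by (auto simp: s_def b1_def)
  have "\<forall>\<^sub>F j in sequentially. col (fan t s b1 j) \<in> K"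
    using palette s K(3) by blast
  then obtain j where j: "distinct (map (\<lambda>i. col (fan t s b1 i)) [j, Suc j, Suc (Suc j)])"
    "col (fan t s b1 j) \<in> K" "col (fan t s b1 (Suc j)) \<in> K"
    and dist2: "\<And>w. \<lbrakk>adj (fan t s b1 (Suc j)) w; w \<notin> range (fan t s b1); w \<notin> {t, s}\<rbrakk> \<Longrightarrow>
      col w \<noteq> col s"
    and dist3: "\<And>w y. \<lbrakk>adj (fan t s b1 (Suc j)) w; adj w y; w \<noteq> y; {w, y} \<inter> range (fan t s b1) = {};
      {w, y} \<inter> {t, s} = {}; col w = col (fan t s b1 j)\<rbrakk> \<Longrightarrow> col y \<noteq> col s"
    by (rule obtain_turn[OF s(2)]) blast
  define q b2 \<alpha> where "q = fan t s b1 (Suc j)" and "b2 = fan t s b1 (Suc (Suc j))"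
    and "\<alpha> = col (fan t s b1 j)"
  have q: "col q \<in> K" "face t q b2" "col q \<noteq> col s" "q \<noteq> s" "q \<noteq> t" "size s < size q"
    using j fan_faces(1)[OF s(2), of "Suc j"] col_fan[OF s(2)] size_fan[of s b1]
    by (auto simp: q_def b2_def size_fan)
  have \<alpha>: "\<alpha> \<in> K - {col s, col q}"
    using j col_fan[OF s(2), of j] by (auto simp: \<alpha>_def q_def)
  have far: "fan t w b i \<notin> range (fan t s b1)" "fan t w b i \<notin> {t, s}" "fan t w b i \<noteq> w"
    if "w \<noteq> s" "size s < size w" for w b i
    using that fan_notin_range[of t w t s] size_fan[of t w b i] size_fan[of w t b i] by auto
  have "\<forall>\<^sub>F i in sequentially. col (fan t q b2 i) \<in> K"
    using palette q K(3) by blast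
  then obtain i where i: "distinct (map (\<lambda>i. col (fan t q b2 i)) [i, Suc i, Suc (Suc i)])"
    "col (fan t q b2 i) \<in> K" "col (fan t q b2 (Suc i)) \<in> K" "col (fan t q b2 (Suc (Suc i))) \<in> K"
    and dist2': "\<And>l w. \<lbrakk>l \<in> {i, Suc i, Suc (Suc i)}; adj (fan t q b2 l) w; w \<notin> range (fan t q b2);
      w \<notin> {t, q}\<rbrakk> \<Longrightarrow> col w \<noteq> col q"
    by (rule obtain_turn[OF q(2)]) blast
  let ?T = "(\<lambda>l. col (fan t q b2 l)) ` {i, Suc i, Suc (Suc i)}"
  have "col (fan t q b2 l) \<noteq> col s" for l
    by (rule dist2[folded q_def]) (use fan_adj(2)[OF q(2)] far[OF q(4,6)] in auto)
  then have "?T \<subseteq> K - {col s, col q}"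
    using i(2-4) col_fan(2)[OF q(2)] by auto
  moreover have "card (K - {col s, col q}) \<le> 3"
    using K(1,2) s(1) q(1,3) by (simp add: card_Diff_subset)
  moreover have "card ?T = 3"
    using i(1) by auto
  ultimately have "?T = K - {col s, col q}"
    using K(1) by (intro card_seteq) auto
  with \<alpha> have "\<alpha> \<in> ?T"
    by (simp only:)
  then obtain l where l: "\<alpha> = col (fan t q b2 l)" "l \<in> {i, Suc i, Suc (Suc i)}"
    by (rule imageE)
  define w b3 where "w = fan t q b2 l" and "b3 = fan t q b2 (Suc l)"
  have w: "col w = \<alpha>" "face t w b3" "size s < size w" "size q < size w" "adj q w"
    using l(1) fan_faces(1)[OF q(2), of l] fan_adj(2)[OF q(2), of l] q(6)
      size_fan(2)[where p = t and q = q and r = b2 and j = l]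
    by (auto simp: w_def b3_def)
  have "\<forall>\<^sub>F i in sequentially. col (fan t w b3 i) \<in> K"
    using palette w \<alpha> K(3) by blast
  then obtain h where h: "distinct (map (\<lambda>i. col (fan t w b3 i)) [h, Suc h, Suc (Suc h)])"
    "col (fan t w b3 h) \<in> K" "col (fan t w b3 (Suc h)) \<in> K" "col (fan t w b3 (Suc (Suc h))) \<in> K"
    by (rule obtain_turn[OF w(2)]) blast
  let ?U = "(\<lambda>l. col (fan t w b3 l)) ` {h, Suc h, Suc (Suc h)}"
  have y: "col (fan t w b3 m) \<noteq> \<alpha>" "col (fan t w b3 m) \<noteq> col q" "col (fan t w b3 m) \<noteq> col s" for m
  proof -
    show "col (fan t w b3 m) \<noteq> \<alpha>"
      using col_fan(2)[OF w(2)] w(1) by simp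
    have adj_y: "adj w (fan t w b3 m)"
      by (rule fan_adj(2)[OF w(2)])
    show "col (fan t w b3 m) \<noteq> col q"
    proof (rule dist2'[OF l(2)])
      show "fan t w b3 m \<notin> range (fan t q b2)"
        using w(4) by (intro fan_notin_range) auto
      show "fan t w b3 m \<notin> {t, q}"
        using w(4) size_fan(2)[where p = t and q = w and r = b3 and j = m] by auto
    qed (use adj_y in \<open>simp add: w_def\<close>)
    show "col (fan t w b3 m) \<noteq> col s"
    proof (rule dist3[folded q_def \<alpha>_def])
      show "{w, fan t w b3 m} \<inter> range (fan t s b1) = {}" "{w, fan t w b3 m} \<inter> {t, s} = {}"
        "w \<noteq> fan t w b3 m"
        using far[OF q(4,6), of b2 l] far[of w b3 m] far(3)[of w b3 m, symmetric] w(3)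
        by (auto simp: w_def)
    qed (use w adj_y in auto)
  qed
  have "?U \<subseteq> K - {col s, col q, \<alpha>}"
    using h(2-4) y by auto
  then have "card ?U \<le> card (K - {col s, col q, \<alpha>})"
    using K(1) by (intro card_mono) auto
  moreover have "card (K - {col s, col q, \<alpha>}) \<le> 2"
    using K(1,2) s(1) q(1,3) \<alpha> by (simp add: card_Diff_subset)
  moreover have "card ?U = 3"
    using h(1) by auto
  ultimately show False
    by linarith
qed

lemma ten_colours_insufficient: False
proof -
  let ?u = Root0 and ?v = Root1
  have root: "face ?u ?v Root2"
    unfolding face_def by (rule exI[of _ 0]) simp
  let ?f = "fan ?u ?v Root2"
  obtain j where j: "distinct (map (\<lambda>i. col (?f i)) [j, Suc j, Suc (Suc j)])"
    and dist2: "\<And>w. \<lbrakk>adj (?f (Suc j)) w; w \<notin> range ?f; w \<notin> {?u, ?v}\<rbrakk> \<Longrightarrow>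
      col w \<noteq> col ?u \<and> col w \<noteq> col ?v"
    and dist3: "\<And>t w. \<lbrakk>adj (?f (Suc j)) t; adj t w; t \<noteq> w; {t, w} \<inter> range ?f = {};
      {t, w} \<inter> {?u, ?v} = {}; col t \<in> {col (?f j), col (?f (Suc (Suc j)))}\<rbrakk>
      \<Longrightarrow> col w \<noteq> col ?u \<and> col w \<noteq> col ?v"
    by (rule obtain_turn[OF root, of "\<lambda>_. True"]) (simp, blast)
  define x s0 where "x = ?f (Suc j)" and "s0 = ?f (Suc (Suc j))"
  have x: "x \<noteq> ?u" "x \<noteq> ?v" "face x s0 (Centre ?v x s0)"
    "col ?u \<noteq> col ?v" "col x \<noteq> col ?u" "col x \<noteq> col ?v"
    using fan_neq face_children(2)[OF fan_faces(2)[OF root, of "Suc j"]] col_face(1)[OF root]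
      col_fan[OF root] by (auto simp: x_def s0_def)
  have s0: "col s0 \<noteq> col ?u" "col s0 \<noteq> col ?v"
    using col_fan[OF root] by (auto simp: s0_def)
  have far: "fan a b c i \<notin> range ?f" "fan a b c i \<notin> {?u, ?v}" if "a \<noteq> ?u" for a b c i
    using that fan_notin_range[of a b ?u ?v] fan_Centre[of a b c i] by auto
  define M where "M = - {col ?u, col ?v}"
  define K where "K = {..<10} - {col ?u, col ?v, col x, col (?f j), col s0}"
  show False
  proof (rule palette_at_least_6[of K M x s0])
    have "card K = 10 - card {col ?u, col ?v, col x, col (?f j), col s0}"
      unfolding K_def by (subst card_Diff_subset) (use col_less in auto)
    also have "card {col ?u, col ?v, col x, col (?f j), col s0} = 5"
      using x(4-6) s0 j col_fan[OF root, of j] by (auto simp: x_def s0_def)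
    finally show "card K \<le> 5"
      by simp
    show "finite K" "K \<subseteq> M" "col s0 \<in> M" "face x s0 (Centre ?v x s0)"
      using x s0 by (auto simp: K_def M_def)
    fix s b
    assume s: "face x s b" "col s \<in> M"
    have "col (fan x s b i) \<in> K" if i: "\<forall>w. adj (fan x s b i) w \<longrightarrow> w \<notin> range (fan x s b) \<longrightarrow>
        w \<notin> {x, s} \<longrightarrow> col w \<noteq> col x \<and> col w \<noteq> col s" for i
    proof (rule ccontr)
      assume notK: "col (fan x s b i) \<notin> K"
      define t where "t = fan x s b i"
      have t: "face t (fan x s b (Suc i)) (Centre s t (fan x s b (Suc i)))"
        "col t \<noteq> col x" "col t \<noteq> col s" "col s \<noteq> col x" "t \<noteq> x" "t \<noteq> s" "t \<noteq> ?u" "adj x t"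
        "size x < size t"
        using face_children(2)[OF fan_faces(2)[OF s(1), of i]] col_fan[OF s(1)] col_face(1)[OF s(1)]
          far(2)[OF x(1), of s b i] fan_adj(1)[OF s(1), of i] size_fan(1)[of x s b i]
        by (auto simp: t_def)
      have t_far: "t \<notin> range ?f" "t \<notin> {?u, ?v}"
        unfolding t_def by (rule far[OF x(1)])+
      have t_uv: "col t \<noteq> col ?u" "col t \<noteq> col ?v"
        using dist2[of t] t_far t(8) by (auto simp: x_def)
      have t_nb: "col t \<in> {col (?f j), col s0}"
        using notK t(2) t_uv col_less[of t] by (auto simp: K_def t_def)
      define L where "L = {..<10} - {col ?u, col ?v, col x, col s, col t}"
      show False
      proof (rule palette_at_least_6[of L UNIV t])
        have "card L = 10 - card {col ?u, col ?v, col x, col s, col t}"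
          unfolding L_def by (subst card_Diff_subset) (use col_less in auto)
        also have "card {col ?u, col ?v, col x, col s, col t} = 5"
          using x(4-6) t(2-4) t_uv s(2) by (auto simp: M_def)
        finally show "card L \<le> 5"
          by simp
        show "face t (fan x s b (Suc i)) (Centre s t (fan x s b (Suc i)))"
          by (rule t(1))
        fix a c
        assume a: "face t a c"
        have "col (fan t a c m) \<in> L" for m
        proof -
          let ?w = "fan t a c m"
          have w: "adj t ?w" "?w \<notin> range (fan x s b)" "t \<noteq> ?w" "col ?w \<noteq> col t" "size t < size ?w"
            using fan_adj(1)[OF a] fan_notin_range[of t a x s] t(5) fan_neq(1)[of t a c m, symmetric]
              col_fan(1)[OF a] size_fan(1) by auto
          have "?w \<notin> {x, s}"
            using w(5) t(9) size_fan(2)[where p = x and q = s and r = b and j = i] by (auto simp: t_def)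
          then have "col ?w \<noteq> col x \<and> col ?w \<noteq> col s"
            using i w(1,2) by (auto simp: t_def)
          moreover have "col ?w \<noteq> col ?u \<and> col ?w \<noteq> col ?v"
            by (rule dist3[of t]) (use far[OF t(7), of a c m] t_far w(1,3) t(8) t_nb in \<open>auto simp: x_def s0_def\<close>)
          ultimately show ?thesis
            using w(4) col_less by (auto simp: L_def)
        qed
        then show "\<forall>\<^sub>F m in sequentially. col (fan t a c m) \<in> L"
          by simp
      qed (auto simp: L_def)
    qed
    then show "\<forall>\<^sub>F i in sequentially. col (fan x s b i) \<in> K"
      using eventually_dist2[OF s(1)] by (auto elim: eventually_mono)
  qed
qed

end


section \<open>Compactness\<close>

lemma ex_avoiding_colorable:
  fixes G :: "nat pair_pre_digraph"
  assumes "finite (pverts G)" "k \<ge> 1"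
  shows "\<exists>n. avoiding_colorable k n G"
proof -
  obtain n where "pverts G \<subseteq> {..<n}"
    using assms(1) finite_nat_iff_bounded by blast
  moreover have "\<not> contains_square G id p" if "p \<ge> k" for p
    using that assms(2) by (auto simp: contains_square_def square_of_period_def vpath_def)
  ultimately have "avoiding_colorable k n G"
    unfolding avoiding_colorable_def by (intro exI[of _ id]) auto
  then show ?thesis ..
qed

lemma pointwise_stable_subsequence:
  fixes g :: "nat \<Rightarrow> 'a::countable \<Rightarrow> nat"
  assumes "\<And>n v. g n v < m"
  obtains r h where "strict_mono (r :: nat \<Rightarrow> nat)" "\<And>v. \<forall>\<^sub>F n in sequentially. g (r n) v = h v"
proof -
  let ?P = "\<lambda>i s. \<exists>x. \<forall>\<^sub>F n in sequentially. g (s n) (from_nat i) = x"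
  interpret subseqs ?P
  proof
    fix i :: nat and s :: "nat \<Rightarrow> nat"
    let ?f = "\<lambda>n. g (s n) (from_nat i)"
    have "finite (range ?f)"
      by (rule finite_subset[of _ "{..<m}"]) (use assms in auto)
    then obtain n0 where "infinite {n. ?f n = ?f n0}"
      using pigeonhole_infinite[of UNIV ?f] by auto
    then have "strict_mono (enumerate {n. ?f n = ?f n0})"
      "\<And>n. ?f (enumerate {n. ?f n = ?f n0} n) = ?f n0"
      using enumerate_in_set by (auto simp: strict_mono_enumerate)
    then show "\<exists>r'. strict_mono r' \<and> ?P i (s \<circ> r')"
      by (intro exI conjI) auto
  qed
  have diag: "?P i (diagseq \<circ> (+) (Suc i))" for i
  proof (rule diagseq_holds)
    fix r s :: "nat \<Rightarrow> nat" and n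
    assume r: "strict_mono r" and "?P n s"
    then obtain x where "\<forall>\<^sub>F l in sequentially. g (s l) (from_nat n) = x" by blast
    then have "\<forall>\<^sub>F l in sequentially. g (s (r l)) (from_nat n) = x"
      by (rule eventually_subseq[OF r])
    then show "?P n (s \<circ> r)" by auto
  qed
  have stable: "\<exists>x. \<forall>\<^sub>F n in sequentially. g (diagseq n) (from_nat i) = x" for i
  proof -
    obtain x N where N: "\<And>n. n \<ge> N \<Longrightarrow> g (diagseq (Suc i + n)) (from_nat i) = x"
      using diag[of i] by (auto simp: eventually_sequentially)
    have "g (diagseq n) (from_nat i) = x" if "n \<ge> N + Suc i" for n
      using N[of "n - Suc i"] that by simp
    then show ?thesis
      unfolding eventually_sequentially by blast
  qed
  have "\<exists>x. \<forall>\<^sub>F n in sequentially. g (diagseq n) v = x" for v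
    using stable[of "to_nat v"] by simp
  then have "\<exists>h. \<forall>v. \<forall>\<^sub>F n in sequentially. g (diagseq n) v = h v"
    by (rule choice[OF allI])
  then obtain h where "\<forall>v. \<forall>\<^sub>F n in sequentially. g (diagseq n) v = h v" ..
  then show thesis
    by (intro that[OF subseq_diagseq]) (rule spec)
qed

lemma vwalk_arcs_adj: "\<lbrakk>successively adj xs; (a, b) \<in> set (vwalk_arcs xs)\<rbrakk> \<Longrightarrow> adj a b"
  by (induction xs rule: vwalk_arcs.induct) auto

lemma vwalk_arcs_map: "set (vwalk_arcs (map f xs)) = map_prod f f ` set (vwalk_arcs xs)"
  by (induction xs rule: vwalk_arcs.induct) auto

lemma set_vwalk_arcs:
  "length xs \<ge> 2 \<Longrightarrow> set xs \<subseteq> fst ` set (vwalk_arcs xs) \<union> snd ` set (vwalk_arcs xs)"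
proof (induction xs rule: vwalk_arcs.induct)
  case (3 a b xs)
  then show ?case by (cases xs) auto
qed auto

lemma eventually_vpath:
  assumes "successively adj xs" "distinct xs" "length xs \<ge> 2"
  shows "\<forall>\<^sub>F n in sequentially. vpath (map to_nat xs) (with_proj (apollonian n))"
proof -
  have "\<forall>\<^sub>F n in sequentially. e \<in> edges n" if "e \<in> set (vwalk_arcs xs)" for e
  proof -
    have "adj (fst e) (snd e)"
      using vwalk_arcs_adj[OF assms(1)] that by simp
    then obtain m where "e \<in> edges m"
      by (auto simp: adj_def)
    then show ?thesis
      using edges_mono unfolding eventually_sequentially by blast
  qed
  then have "\<forall>\<^sub>F n in sequentially. \<forall>e\<in>set (vwalk_arcs xs). e \<in> edges n"
    by (intro eventually_ball_finite) auto
  then show ?thesis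
  proof (rule eventually_mono)
    fix n assume arcs: "\<forall>e\<in>set (vwalk_arcs xs). e \<in> edges n"
    have "{fst e, snd e} \<subseteq> nodes n" if "e \<in> set (vwalk_arcs xs)" for e
      using edges_nodes[of "fst e" "snd e" n] arcs that by simp
    then have "fst ` set (vwalk_arcs xs) \<union> snd ` set (vwalk_arcs xs) \<subseteq> nodes n"
      by blast
    then have "set xs \<subseteq> nodes n"
      using set_vwalk_arcs[OF assms(3)] by (rule subset_trans[rotated])
    then show "vpath (map to_nat xs) (with_proj (apollonian n))"
      using arcs assms(2,3) unfolding vpath_def vwalk_def
      by (auto simp: vwalk_arcs_map apollonian_def distinct_map)
  qed
qed

theorem theorem4:
  fixes k :: nat
  assumes "k \<ge> 1"
  shows "pi_class k (planar_graphs \<inter> tw_graphs 3 :: nat pair_pre_digraph set) \<ge> 11"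
proof (rule ccontr)
  assume "\<not> ?thesis"
  then have less: "pi_class k (planar_graphs \<inter> tw_graphs 3 :: nat pair_pre_digraph set) < 11"
    by simp
  have "\<exists>c :: nat \<Rightarrow> nat. c ` pverts (apollonian n) \<subseteq> {..<10} \<and> (\<forall>p\<ge>k. \<not> contains_square (apollonian n) c p)" for n
  proof -
    have "enat (pi_graph k (apollonian n)) \<le>
        pi_class k (planar_graphs \<inter> tw_graphs 3 :: nat pair_pre_digraph set)"
      unfolding pi_class_def by (rule SUP_upper) (use planar_apollonian apollonian_tw in blast)
    from this less have "enat (pi_graph k (apollonian n)) < 11"
      by (rule le_less_trans)
    then have le: "pi_graph k (apollonian n) \<le> 10"
      by (simp add: numeral_eq_enat)
    have "finite (pverts (apollonian n))"
      by (simp add: apollonian_def finite_nodes)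
    from ex_avoiding_colorable[OF this assms]
    have "avoiding_colorable k (pi_graph k (apollonian n)) (apollonian n)"
      unfolding pi_graph_def by (rule LeastI_ex)
    then obtain c where "c ` pverts (apollonian n) \<subseteq> {..<pi_graph k (apollonian n)}"
      "\<forall>p\<ge>k. \<not> contains_square (apollonian n) c p"
      unfolding avoiding_colorable_def by blast
    moreover have "{..<pi_graph k (apollonian n)} \<subseteq> {..<10}"
      using le by simp
    ultimately show ?thesis
      by (meson subset_trans)
  qed
  then have "\<exists>c :: nat \<Rightarrow> nat \<Rightarrow> nat. \<forall>n. c n ` pverts (apollonian n) \<subseteq> {..<10} \<and>
      (\<forall>p\<ge>k. \<not> contains_square (apollonian n) (c n) p)"
    by (rule choice[OF allI])
  then obtain c :: "nat \<Rightarrow> nat \<Rightarrow> nat" where c_all: "\<forall>n. c n ` pverts (apollonian n) \<subseteq> {..<10} \<and>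
      (\<forall>p\<ge>k. \<not> contains_square (apollonian n) (c n) p)" ..
  then have c: "c n ` pverts (apollonian n) \<subseteq> {..<10}"
    "p \<ge> k \<Longrightarrow> \<not> contains_square (apollonian n) (c n) p" for n p
    by simp_all
  define g where "g n v = (if v \<in> nodes n then c n (to_nat v) else 0)" for n and v :: vertex
  have g_less: "g n v < 10" for n v
    using c(1)[of n] by (auto simp: g_def apollonian_def)
  obtain r col where r: "strict_mono (r :: nat \<Rightarrow> nat)"
    and col: "\<And>v. \<forall>\<^sub>F n in sequentially. g (r n) v = col v"
    by (rule pointwise_stable_subsequence[of g, OF g_less]) (rule that)
  interpret long_square_free k col
  proof
    show "k \<ge> 1" by (rule assms)
    fix v
    obtain n where "g (r n) v = col v"
      using eventually_happens'[OF sequentially_bot col[of v]] by blast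
    with g_less[of "r n" v] show "col v < 10"
      by simp
  next
    fix vs ws
    assume vs: "k \<le> length vs" "distinct (vs @ ws)" "successively adj (vs @ ws)"
    show "map col vs \<noteq> map col ws"
    proof
      assume eq: "map col vs = map col ws"
      have len: "length vs = length ws"
        using arg_cong[OF eq, of length] by simp
      have "\<forall>\<^sub>F n in sequentially. vpath (map to_nat (vs @ ws)) (with_proj (apollonian (r n)))"
        by (rule eventually_subseq[OF r]) (intro eventually_vpath vs, use vs(1) len assms in simp)
      moreover have "\<forall>\<^sub>F n in sequentially. \<forall>v\<in>set (vs @ ws). g (r n) v = col v"
        by (intro eventually_ball_finite) (use col in auto)
      ultimately have "\<forall>\<^sub>F n in sequentially. vpath (map to_nat (vs @ ws)) (with_proj (apollonian (r n))) \<and>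
          (\<forall>v\<in>set (vs @ ws). g (r n) v = col v)"
        by (rule eventually_conj)
      then obtain n where n: "vpath (map to_nat (vs @ ws)) (with_proj (apollonian (r n)))"
        "\<forall>v\<in>set (vs @ ws). g (r n) v = col v"
        using eventually_happens'[OF sequentially_bot] by blast
      have nodes: "set (vs @ ws) \<subseteq> nodes (r n)"
        using n(1) by (auto simp: vpath_def vwalk_def apollonian_def)
      have "c (r n) (to_nat v) = col v" if "v \<in> set (vs @ ws)" for v
        using bspec[OF n(2) that] subsetD[OF nodes that] by (simp add: g_def)
      then have g: "map (c (r n) \<circ> to_nat) us = map col us" if "set us \<subseteq> set (vs @ ws)" for us
        using that by auto
      have "square_of_period (length vs) (map (c (r n)) (map to_nat (vs @ ws)))"
        unfolding square_of_period_def using g[of vs] g[of ws] eq len vs(1) assms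
        by (intro exI[of _ "map col vs"]) auto
      then have "contains_square (apollonian (r n)) (c (r n)) (length vs)"
        using n(1) unfolding contains_square_def by blast
      then show False
        using c(2) vs(1) by blast
    qed
  qed
  show False
    by (rule ten_colours_insufficient)
qed

end
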